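(* Let $X$ be a Banach space with a basis $(x_i)$. Let $(n_j)$, $(k_j)$ be increasing sequences of positive integers such that $k_j<n_j$ for all $j\in\mathbb{N}$, let $(\delta_j)$ be a null sequence of positive scalars, and let $c_1,c_2,c_3$ be positive constants. Assume that for every block subspace $Y$ of $X$ and every $j\in\mathbb{N}$ there exists a block basis $z_1<\cdots<z_p$ of $(x_i)$ in $Y$ such that, letting $t_i=\min\operatorname{supp} z_i$ ($i\le p$), the following are satisfied: (1) $\{t_i:i\le p\}$ is a maximal (under inclusion) member of $S_{n_j}$ and $\|\sum_{i=1}^pa_iz_i\|\ge c_1\delta_j\|\sum_{i=1}^pa_ie_{t_i}\|_{n_j}$ for every sequence $(a_i)_{i=1}^p$ in $\mathbb{R}^+$. (2) $\|\sum_{i=1}^pa_iz_i\|\le c_2\|\sum_{i=1}^pa_ie_{t_i}\|_{Ck_j}+c_3\delta_j^2$ for every sequence $(a_i)_{i=1}^p$ in $\mathbb{R}$ with $\sum_{i=1}^p|a_i|\le1$. Here $c_1,c_2,c_3$ do not depend on $Y$, $j$ or the block basis. Then $X$ has no infinite unconditional (basic) sequence. If moreover, given block subspaces $Y$, $Z$ of $X$ and $j\in\mathbb{N}$, a block basis $(z_i)_{i=1}^p$ of $(x_i)$ satisfying (1) and (2) can be found with the additional property that $z_i\in Y$ if $i$ is odd, while $z_i\in Z$ if $i$ is even, then $X$ is H.I.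
   Context: All Banach spaces are real and infinite dimensional; a subspace means an infinite dimensional closed linear subspace. $X$ is Hereditarily Indecomposable (H.I.) if for every pair $Y,Z$ of subspaces of $X$ with $Y\cap Z=\{0\}$, $Y+Z$ is not closed. A (finite or infinite) block basis of $(x_i)$ is a sequence of non-zero vectors $u_n=\sum_{i\in F_n}a_ix_i$ with $F_1<F_2<\cdots$ finite subsets of $\mathbb{N}$ ($E<F$ means $\max E<\min F$); $\operatorname{supp}u_n=\{i\in F_n:a_i\ne0\}$; one writes $u_1<u_2<\cdots$. A block subspace of $X$ is the closed linear span of an infinite block basis of $(x_i)$. Schreier families: $S_0=\{\{n\}:n\in\mathbb{N}\}\cup\{\emptyset\}$ and, for $\xi<\omega$, $S_{\xi+1}=\{\bigcup_{i=1}^n F_i: n\in\mathbb{N},\ n\le\min F_1,\ F_1<\cdots<F_n,\ F_i\in S_\xi\ (i\le n)\}\cup\{\emptyset\}$. $(e_i)$ is the unit vector basis of $c_{00}$, the space of finitely supported real sequences. For $\xi<\omega$ and $x\in c_{00}$: $\|x\|_\xi=\sup\{\sum_{i\in F}|x(i)|:F\in S_\xi\}$ (Schreier norm), and $\|x\|_{C\xi}=\sup\{\sum_{k=1}^n|\sum_{i\in J_k}x(i)|:\ n\in\mathbb{N},\ J_1<\cdots<J_n$ intervals of $\mathbb{N}$ with $\{\min J_k:k\le n\}\in S_\xi\}$ (conditional Schreier norm). *)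

theory Defs
  imports "HOL-Analysis.Analysis"
begin

text \<open>
  The natural numbers are taken to start at 1, i.e. they are \<open>{1..}\<close>; this matters for the
  Schreier families. Sequences are functions on \<open>nat\<close> whose value at \<open>0\<close> is never used.
\<close>

text \<open>The clause \<open>a 0 = 0\<close> only normalizes the unused coefficient, so that \<open>a\<close> can be unique.\<close>

definition basis_expansion :: "(nat \<Rightarrow> 'a::real_normed_vector) \<Rightarrow> 'a \<Rightarrow> (nat \<Rightarrow> real) \<Rightarrow> bool" where
  "basis_expansion x v a \<longleftrightarrow> a 0 = 0 \<and> (\<lambda>N. \<Sum>i=1..N. a i *\<^sub>R x i) \<longlonglongrightarrow> v"

definition schauder_basis_of :: "(nat \<Rightarrow> 'a::real_normed_vector) \<Rightarrow> 'a set \<Rightarrow> bool" where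
  "schauder_basis_of x V \<longleftrightarrow> (\<forall>i\<ge>1. x i \<in> V) \<and> (\<forall>v\<in>V. \<exists>!a. basis_expansion x v a)"

definition closed_span :: "'a::real_normed_vector set \<Rightarrow> 'a set" where
  "closed_span B = closure (span B)"

definition basic_sequence :: "(nat \<Rightarrow> 'a::real_normed_vector) \<Rightarrow> bool" where
  "basic_sequence u \<longleftrightarrow> schauder_basis_of u (closed_span (u ` {1..}))"

text \<open>Unconditional convergence of a series is convergence of the net of its finite partial sums,
  i.e. \<^const>\<open>summable_on\<close>.\<close>

definition unconditional_basic_sequence :: "(nat \<Rightarrow> 'a::real_normed_vector) \<Rightarrow> bool" where
  "unconditional_basic_sequence u \<longleftrightarrow>
     basic_sequence u \<and>
     (\<forall>a :: nat \<Rightarrow> real. convergent (\<lambda>N. \<Sum>i=1..N. a i *\<^sub>R u i) \<longrightarrow>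
        (\<lambda>i. a i *\<^sub>R u i) summable_on {1..})"

definition infinite_dimensional :: "'a::real_vector set \<Rightarrow> bool" where
  "infinite_dimensional V \<longleftrightarrow> \<not> (\<exists>B. finite B \<and> V \<subseteq> span B)"

definition inf_dim_closed_subspace :: "'a::real_normed_vector set \<Rightarrow> bool" where
  "inf_dim_closed_subspace Y \<longleftrightarrow> subspace Y \<and> closed Y \<and> infinite_dimensional Y"

definition hereditarily_indecomposable :: "'a::real_normed_vector set \<Rightarrow> bool" where
  "hereditarily_indecomposable X \<longleftrightarrow>
     (\<forall>Y Z. Y \<subseteq> X \<longrightarrow> Z \<subseteq> X \<longrightarrow>
        inf_dim_closed_subspace Y \<longrightarrow> inf_dim_closed_subspace Z \<longrightarrow> Y \<inter> Z = {0} \<longrightarrow>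
        \<not> closed {y + z | y z. y \<in> Y \<and> z \<in> Z})"

text \<open>For nonempty finite sets this is \<open>Max E < Min F\<close>.\<close>

definition set_less :: "nat set \<Rightarrow> nat set \<Rightarrow> bool" where
  "set_less E F \<longleftrightarrow> (\<forall>i\<in>E. \<forall>j\<in>F. i < j)"

text \<open>The index set \<open>I\<close> is \<open>{1..p}\<close> for a finite block basis and \<open>{1..}\<close> for an infinite one.\<close>

definition block_basis ::
    "(nat \<Rightarrow> 'a::real_normed_vector) \<Rightarrow> nat set \<Rightarrow> (nat \<Rightarrow> 'a) \<Rightarrow> bool" where
  "block_basis x I u \<longleftrightarrow>
     (\<exists>(F :: nat \<Rightarrow> nat set) (a :: nat \<Rightarrow> real).
        (\<forall>n\<in>I. finite (F n) \<and> F n \<subseteq> {1..} \<and> u n \<noteq> 0 \<and> u n = (\<Sum>i\<in>F n. a i *\<^sub>R x i)) \<and>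
        (\<forall>m\<in>I. \<forall>n\<in>I. m < n \<longrightarrow> set_less (F m) (F n)))"

definition block_subspace :: "(nat \<Rightarrow> 'a::real_normed_vector) \<Rightarrow> 'a set \<Rightarrow> bool" where
  "block_subspace x Y \<longleftrightarrow> (\<exists>u. block_basis x {1..} u \<and> Y = closed_span (u ` {1..}))"

text \<open>When \<open>x\<close> is a basis and \<open>v = (\<Sum>i\<in>F. a i *\<^sub>R x i)\<close> with \<open>F\<close> a finite subset of \<open>{1..}\<close>, uniqueness
  of the expansion gives \<open>supp x v = {i \<in> F. a i \<noteq> 0}\<close>.\<close>

definition coords :: "(nat \<Rightarrow> 'a::real_normed_vector) \<Rightarrow> 'a \<Rightarrow> nat \<Rightarrow> real" where
  "coords x v = (THE a. basis_expansion x v a)"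

definition supp :: "(nat \<Rightarrow> 'a::real_normed_vector) \<Rightarrow> 'a \<Rightarrow> nat set" where
  "supp x v = {i. 1 \<le> i \<and> coords x v i \<noteq> 0}"

definition min_supp :: "(nat \<Rightarrow> 'a::real_normed_vector) \<Rightarrow> 'a \<Rightarrow> nat" where
  "min_supp x v = Min (supp x v)"

primrec schreier :: "nat \<Rightarrow> nat set set" where
  "schreier 0 = {{n} | n. 1 \<le> n} \<union> {{}}"
| "schreier (Suc \<xi>) =
     {(\<Union>i\<in>{1..n}. F i) | (n :: nat) (F :: nat \<Rightarrow> nat set).
        1 \<le> n \<and> n \<le> Min (F 1) \<and>
        (\<forall>i\<in>{1..n}. F i \<in> schreier \<xi> \<and> F i \<noteq> {}) \<and>
        (\<forall>i\<in>{1..n}. \<forall>j\<in>{1..n}. i < j \<longrightarrow> set_less (F i) (F j))} \<union> {{}}"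

definition maximal_schreier :: "nat \<Rightarrow> nat set \<Rightarrow> bool" where
  "maximal_schreier \<xi> F \<longleftrightarrow> F \<in> schreier \<xi> \<and> (\<forall>G\<in>schreier \<xi>. F \<subseteq> G \<longrightarrow> G = F)"

text \<open>Elements of \<open>c\<^sub>0\<^sub>0\<close> are finitely supported functions; the suprema below are over
  bounded sets for these.\<close>

definition unit_vec :: "nat \<Rightarrow> nat \<Rightarrow> real" where
  "unit_vec m = (\<lambda>i. if i = m then 1 else 0)"

definition schreier_norm :: "nat \<Rightarrow> (nat \<Rightarrow> real) \<Rightarrow> real" where
  "schreier_norm \<xi> x = (SUP F\<in>schreier \<xi>. \<Sum>i\<in>F. \<bar>x i\<bar>)"

definition nat_interval :: "nat set \<Rightarrow> bool" where
  "nat_interval J \<longleftrightarrow> J \<noteq> {} \<and> J \<subseteq> {1..} \<and> (\<forall>l\<in>J. \<forall>m\<in>J. {l..m} \<subseteq> J)"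

text \<open>The last interval may be infinite, hence the restriction of the inner sum to the (finite)
  support of \<open>x\<close> and the use of \<^const>\<open>Inf\<close> rather than \<^const>\<open>Min\<close> for the minimum.\<close>

definition cond_schreier_norm :: "nat \<Rightarrow> (nat \<Rightarrow> real) \<Rightarrow> real" where
  "cond_schreier_norm \<xi> x =
     Sup {(\<Sum>k=1..n. \<bar>\<Sum>i\<in>{i\<in>J k. x i \<noteq> 0}. x i\<bar>) | (n :: nat) (J :: nat \<Rightarrow> nat set).
            1 \<le> n \<and> (\<forall>k\<in>{1..n}. nat_interval (J k)) \<and>
            (\<forall>k\<in>{1..n}. \<forall>l\<in>{1..n}. k < l \<longrightarrow> set_less (J k) (J l)) \<and>
            {Inf (J k) | k. k \<in> {1..n}} \<in> schreier \<xi>}"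

text \<open>The vector \<open>\<Sum>i\<le>p. a\<^sub>i e\<^bsub>t\<^sub>i\<^esub>\<close> of \<open>c\<^sub>0\<^sub>0\<close>, where \<open>t\<^sub>i\<close> is the minimum of the support of \<open>z\<^sub>i\<close>.\<close>

definition min_supp_vec ::
    "(nat \<Rightarrow> 'a::real_normed_vector) \<Rightarrow> nat \<Rightarrow> (nat \<Rightarrow> 'a) \<Rightarrow> (nat \<Rightarrow> real) \<Rightarrow> nat \<Rightarrow> real" where
  "min_supp_vec x p z a = (\<lambda>m. \<Sum>i=1..p. a i * unit_vec (min_supp x (z i)) m)"

definition lower_estimate ::
    "(nat \<Rightarrow> 'a::real_normed_vector) \<Rightarrow> nat \<Rightarrow> real \<Rightarrow> real \<Rightarrow> nat \<Rightarrow> (nat \<Rightarrow> 'a) \<Rightarrow> bool" where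
  "lower_estimate x n c d p z \<longleftrightarrow>
     maximal_schreier n {min_supp x (z i) | i. i \<in> {1..p}} \<and>
     (\<forall>a :: nat \<Rightarrow> real. (\<forall>i\<in>{1..p}. 0 < a i) \<longrightarrow>
        norm (\<Sum>i=1..p. a i *\<^sub>R z i) \<ge> c * d * schreier_norm n (min_supp_vec x p z a))"

definition upper_estimate ::
    "(nat \<Rightarrow> 'a::real_normed_vector) \<Rightarrow> nat \<Rightarrow> real \<Rightarrow> real \<Rightarrow> real \<Rightarrow> nat \<Rightarrow> (nat \<Rightarrow> 'a) \<Rightarrow> bool" where
  "upper_estimate x k c c' d p z \<longleftrightarrow>
     (\<forall>a :: nat \<Rightarrow> real. (\<Sum>i=1..p. \<bar>a i\<bar>) \<le> 1 \<longrightarrow>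
        norm (\<Sum>i=1..p. a i *\<^sub>R z i)
          \<le> c * cond_schreier_norm k (min_supp_vec x p z a) + c' * d\<^sup>2)"

end

theory Submission imports Defs
begin

text \<open>Both assertions follow from one contradiction. Suppose that the space contains an unconditional
  sequence, or two subspaces with closed direct sum. A gliding hump then gives block subspaces such
  that, for the block bases \<open>z\<close> with (1) and (2) found in them, the norm of \<open>\<Sum>i. a i *\<^sub>R z i\<close> is at most a
  constant times that of \<open>\<Sum>i. ((-1) ^ i * a i) *\<^sub>R z i\<close>. Let \<open>a\<close> be a repeated average on the maximal
  Schreier set of the minima \<open>t i\<close> of the supports. By (1) the former norm is at least \<open>c1 * \<delta> j\<close>. An
  alternating sum of decreasing terms over an interval is bounded by its first term, so the
  conditional Schreier norm of order \<open>k j\<close> of the alternating vector is at most the Schreier norm of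
  order \<open>k j < n j\<close> of the average, which is at most \<open>2 ^ n j / t 1\<close>. As \<open>t 1\<close> can be taken arbitrarily
  large, (2) bounds the latter norm by a multiple of \<open>(\<delta> j)\<^sup>2\<close>, which is impossible for large \<open>j\<close>.\<close>

subsection \<open>Schreier families\<close>

text \<open>Both cases reduce to one estimate,
  \<open>norm A' + norm B' \<le> L * norm (A' - B')\<close>, for approximations \<open>A'\<close>
  and \<open>B'\<close> of the odd and even parts of \<open>\<Sum>i. a i *\<^sub>R z i\<close>. For
  two subspaces it is the boundedness of a projection. For an unconditional sequence
  \<open>u\<close> it needs \<open>A'\<close> and \<open>B'\<close> supported on disjoint sets of
  indices of \<open>u\<close>. The obstacle is that the \<open>z i\<close> are blocks of
  \<open>x\<close>, not of the hump vectors \<open>w m\<close>. One marked coordinate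
  \<open>\<iota> m\<close> per hump decides whether \<open>w m\<close> occurs in a vector, so
  vectors with disjoint supports over \<open>x\<close> use disjoint sets of humps. Hypothesis (1)
  says only that the set of minima is maximal, so an average is required on every maximal Schreier
  set; hence the structural description of these sets. A basis is given by unique expansions alone.
  Continuity of coordinates, the unconditional constant and the bounded projection of a direct sum
  all come from one principle on countably subadditive seminorms. The domination constant may be any
  number independent of \<open>j\<close>, because \<open>\<delta> j\<close> is compared with
  \<open>(\<delta> j)\<^sup>2\<close>.\<close>

lemma set_less_mono: "set_less A B \<Longrightarrow> A' \<subseteq> A \<Longrightarrow> B' \<subseteq> B \<Longrightarrow> set_less A' B'"
  by (auto simp: set_less_def)

lemma Union_set_nth: "\<Union>(set Fs) = (\<Union>l<length Fs. Fs ! l)"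
  unfolding set_conv_nth by blast

lemma sorted_sets_cases:
  assumes "sorted_wrt set_less Fs" "G \<in> set Fs" "H \<in> set Fs"
  shows "G = H \<or> set_less G H \<or> set_less H G"
  using assms by (induction Fs) auto

lemma sorted_sets_distinct:
  assumes "sorted_wrt set_less Fs" "{} \<notin> set Fs"
  shows "distinct Fs"
  using assms by (induction Fs) (auto simp: set_less_def)

text \<open>Each successive nonempty set uses up at least one new integer between \<open>M\<close>
  and \<open>y\<close>. This is the counting behind the doubling of minima of full sets.\<close>

lemma sorted_sets_length:
  assumes "sorted_wrt set_less Fs" "{} \<notin> set Fs" "\<forall>i\<in>\<Union>(set Fs). M \<le> i \<and> i < y" "M \<le> y"
  shows "M + length Fs \<le> y"
  using assms
proof (induction Fs arbitrary: M)
  case (Cons G Gs)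
  then obtain g where g: "g \<in> G" by auto
  then have gM: "M \<le> g" "g < y" using Cons.prems(3) by auto
  have "Suc g + length Gs \<le> y"
  proof (rule Cons.IH)
    show "\<forall>i\<in>\<Union>(set Gs). Suc g \<le> i \<and> i < y"
      using Cons.prems g by (auto simp: set_less_def Suc_le_eq)
    show "Suc g \<le> y" using gM by simp
  qed (use Cons.prems in auto)
  then show ?case using gM by simp
qed simp

lemma schreier_finite: "F \<in> schreier n \<Longrightarrow> finite F"
  by (induction n arbitrary: F) auto

lemma schreier_subset: "F \<in> schreier n \<Longrightarrow> F \<subseteq> {1..}"
proof (induction n arbitrary: F)
  case (Suc n)
  show ?case
  proof
    fix m assume "m \<in> F"
    then obtain G where "G \<in> schreier n" "m \<in> G" using Suc.prems by auto
    then show "m \<in> {1..}" using Suc.IH by blast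
  qed
qed auto

lemma empty_in_schreier [simp]: "{} \<in> schreier n"
  by (cases n) auto

text \<open>Empty pieces are permitted here, which makes restrictions of a decomposition immediate.\<close>

lemma schreier_Suc_iff:
  "F \<in> schreier (Suc n) \<longleftrightarrow>
    (\<exists>Fs. F = \<Union>(set Fs) \<and> set Fs \<subseteq> schreier n \<and> sorted_wrt set_less Fs \<and> (\<forall>m\<in>F. length Fs \<le> m))"
proof
  assume "F \<in> schreier (Suc n)"
  then consider "F = {}" | q G where "1 \<le> q" "q \<le> Min (G 1)"
    "\<forall>i\<in>{1..q}. G i \<in> schreier n \<and> G i \<noteq> {}"
    "\<forall>i\<in>{1..q}. \<forall>j\<in>{1..q}. i < j \<longrightarrow> set_less (G i) (G j)" "F = (\<Union>i\<in>{1..q}. G i)"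
    by auto
  then show "\<exists>Fs. F = \<Union>(set Fs) \<and> set Fs \<subseteq> schreier n \<and> sorted_wrt set_less Fs \<and> (\<forall>m\<in>F. length Fs \<le> m)"
  proof cases
    case 1
    then show ?thesis by (intro exI[of _ "[]"]) auto
  next
    case 2
    let ?Fs = "map G [1..<Suc q]"
    have fin: "finite (G 1)" "G 1 \<noteq> {}"
      using 2(1,3) schreier_finite by fastforce+
    have "sorted_wrt set_less ?Fs"
      using 2(4) by (simp add: sorted_wrt_iff_nth_less del: upt_Suc)
    moreover have "q \<le> m" if m: "m \<in> F" for m
    proof -
      obtain i where i: "i \<in> {1..q}" "m \<in> G i" using m 2(5) by auto
      have "Min (G 1) \<le> m"
      proof (cases "i = 1")
        case True
        then show ?thesis using i fin by auto
      next
        case False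
        then have "set_less (G 1) (G i)" using 2 i by auto
        then have "Min (G 1) < m" using fin i by (auto simp: set_less_def)
        then show ?thesis by simp
      qed
      then show ?thesis using 2 by simp
    qed
    moreover have "set [1..<Suc q] = {1..q}" by auto
    moreover have "F = \<Union>(set ?Fs)" "set ?Fs \<subseteq> schreier n"
      using 2(3,5) calculation(3) by (auto simp del: upt_Suc)
    moreover have "length ?Fs = q" by simp
    ultimately show ?thesis by metis
  qed
next
  assume "\<exists>Fs. F = \<Union>(set Fs) \<and> set Fs \<subseteq> schreier n \<and> sorted_wrt set_less Fs \<and> (\<forall>m\<in>F. length Fs \<le> m)"
  then obtain Fs where Fs: "F = \<Union>(set Fs)" "set Fs \<subseteq> schreier n" "sorted_wrt set_less Fs"
    "\<forall>m\<in>F. length Fs \<le> m" by auto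
  show "F \<in> schreier (Suc n)"
  proof (cases "F = {}")
    case False
    define Gs where "Gs = filter (\<lambda>G. G \<noteq> {}) Fs"
    have Gs: "F = \<Union>(set Gs)" "set Gs \<subseteq> schreier n - {{}}" "sorted_wrt set_less Gs" "length Gs \<le> length Fs"
      using Fs by (auto simp: Gs_def sorted_wrt_filter)
    have ne: "Gs \<noteq> []" using Gs(1) False by auto
    define q where "q = length Gs"
    have q: "1 \<le> q" using ne by (simp add: q_def Suc_le_eq)
    have nth: "Gs ! (i - 1) \<in> set Gs" if "i \<in> {1..q}" for i
      using that by (intro nth_mem) (auto simp: q_def)
    have "Gs ! 0 \<in> set Gs" using ne by simp
    then have "Min (Gs ! 0) \<in> F" using Gs schreier_finite by (metis DiffE Min_in UnionI insertI1 subsetD)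
    then have "length Fs \<le> Min (Gs ! 0)" using Fs(4) by blast
    then have "q \<le> Min (Gs ! 0)" using Gs(4) q_def by simp
    moreover have "F = (\<Union>i\<in>{1..q}. Gs ! (i - 1))"
    proof
      show "(\<Union>i\<in>{1..q}. Gs ! (i - 1)) \<subseteq> F" using nth Gs(1) by auto
      show "F \<subseteq> (\<Union>i\<in>{1..q}. Gs ! (i - 1))"
      proof
        fix m assume "m \<in> F"
        then obtain i where "i < q" "m \<in> Gs ! i" using Gs(1) q_def by (auto simp: in_set_conv_nth)
        then show "m \<in> (\<Union>i\<in>{1..q}. Gs ! (i - 1))" by (intro UN_I[of "Suc i"]) auto
      qed
    qed
    moreover have "\<forall>i\<in>{1..q}. \<forall>j\<in>{1..q}. i < j \<longrightarrow> set_less (Gs ! (i-1)) (Gs ! (j-1))"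
      using Gs(3) by (auto simp: sorted_wrt_iff_nth_less q_def)
    moreover have "\<forall>i\<in>{1..q}. Gs ! (i-1) \<in> schreier n \<and> Gs ! (i-1) \<noteq> {}"
      using nth Gs(2) by blast
    ultimately show ?thesis using q
      by (simp, intro disjI2 exI[of _ q] exI[of _ "\<lambda>i. Gs ! (i - 1)"]) simp
  qed simp
qed

lemma schreier_hereditary: "F \<in> schreier n \<Longrightarrow> G \<subseteq> F \<Longrightarrow> G \<in> schreier n"
proof (induction n arbitrary: F G)
  case (Suc n)
  then obtain Fs where Fs: "F = \<Union>(set Fs)" "set Fs \<subseteq> schreier n" "sorted_wrt set_less Fs"
    "\<forall>m\<in>F. length Fs \<le> m" by (metis schreier_Suc_iff)
  let ?Gs = "map (\<lambda>H. H \<inter> G) Fs"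
  have "sorted_wrt set_less ?Gs"
    using Fs(3) unfolding sorted_wrt_map by (rule sorted_wrt_mono_rel[rotated]) (auto simp: set_less_def)
  moreover have "set ?Gs \<subseteq> schreier n" using Fs(2) Suc.IH by auto
  moreover have "G = \<Union>(set ?Gs)" using Fs(1) Suc.prems(2) by auto
  moreover have "\<forall>m\<in>G. length ?Gs \<le> m" using Fs(4) Suc.prems(2) by auto
  ultimately show ?case unfolding schreier_Suc_iff by blast
qed auto

lemma schreier_spreading:
  assumes "F \<in> schreier n" "strict_mono_on F f" "\<And>i. i \<in> F \<Longrightarrow> i \<le> f i"
  shows "f ` F \<in> schreier n"
  using assms
proof (induction n arbitrary: F)
  case 0
  then show ?case by fastforce
next
  case (Suc n)
  then obtain Fs where Fs: "F = \<Union>(set Fs)" "set Fs \<subseteq> schreier n" "sorted_wrt set_less Fs"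
    "\<forall>m\<in>F. length Fs \<le> m" by (metis schreier_Suc_iff)
  let ?Gs = "map ((`) f) Fs"
  have "sorted_wrt set_less ?Gs"
    using Fs(3) unfolding sorted_wrt_map
  proof (rule sorted_wrt_mono_rel[rotated])
    fix A B assume "A \<in> set Fs" "B \<in> set Fs" "set_less A B"
    then show "set_less (f ` A) (f ` B)"
      using Suc.prems(2) Fs(1) unfolding set_less_def strict_mono_on_def by blast
  qed
  moreover have "set ?Gs \<subseteq> schreier n"
  proof -
    have "f ` A \<in> schreier n" if "A \<in> set Fs" for A
    proof (rule Suc.IH)
      show "strict_mono_on A f" "\<And>i. i \<in> A \<Longrightarrow> i \<le> f i"
        using Suc.prems Fs(1) that by (auto simp: strict_mono_on_def)
    qed (use Fs that in auto)
    then show ?thesis by auto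
  qed
  moreover have "\<forall>m\<in>f ` F. length ?Gs \<le> m" using Fs(4) Suc.prems(3) by (auto intro: order_trans)
  moreover have "f ` F = \<Union>(set ?Gs)" using Fs(1) by auto
  ultimately show ?case unfolding schreier_Suc_iff by blast
qed

lemma schreier_mono: "m \<le> n \<Longrightarrow> schreier m \<subseteq> schreier n"
proof (induction n rule: dec_induct)
  case (step n)
  have "schreier n \<subseteq> schreier (Suc n)"
  proof
    fix F assume F: "F \<in> schreier n"
    then show "F \<in> schreier (Suc n)"
      unfolding schreier_Suc_iff using schreier_subset[OF F] by (intro exI[of _ "[F]"]) auto
  qed
  then show ?case using step by blast
qed simp

text \<open>Spreading along \<open>g\<close> composed with the inverse of \<open>h\<close>. The
  common index set \<open>K\<close> fits the application, where \<open>h\<close> gives the minima of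
  intervals and \<open>g\<close> later points of the same intervals.\<close>

lemma schreier_indexed_spreading:
  fixes h g :: "'i::linorder \<Rightarrow> nat"
  assumes "h ` K \<in> schreier n" "strict_mono_on K h" "strict_mono_on K g" "\<And>i. i \<in> K \<Longrightarrow> h i \<le> g i"
  shows "g ` K \<in> schreier n"
proof -
  have inj: "inj_on h K" using assms(2) by (rule strict_mono_on_imp_inj_on)
  let ?f = "\<lambda>m. g (inv_into K h m)"
  have "?f ` (h ` K) \<in> schreier n"
  proof (rule schreier_spreading[OF assms(1)])
    show "strict_mono_on (h ` K) ?f"
    proof (rule strict_mono_onI)
      fix r s assume "r \<in> h ` K" "s \<in> h ` K" "r < s"
      then obtain i j where ij: "i \<in> K" "j \<in> K" "r = h i" "s = h j" "h i < h j" by auto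
      then have "i < j" using strict_mono_on_less[OF assms(2)] by auto
      then show "?f r < ?f s" using ij inj assms(3) by (simp add: strict_mono_on_def)
    qed
    show "\<And>i. i \<in> h ` K \<Longrightarrow> i \<le> ?f i" using inj assms(4) by auto
  qed
  moreover have "?f ` (h ` K) = g ` K" using inj by (force simp: image_image)
  ultimately show ?thesis by simp
qed

text \<open>The sets built from the maximal number of pieces at every stage; these turn out to be the
  maximal members of the Schreier family.\<close>

primrec full_schreier :: "nat \<Rightarrow> nat set \<Rightarrow> bool" where
  "full_schreier 0 F \<longleftrightarrow> (\<exists>m\<ge>1. F = {m})"
| "full_schreier (Suc n) F \<longleftrightarrow>
     (\<exists>Fs. F = \<Union>(set Fs) \<and> F \<noteq> {} \<and> (\<forall>G\<in>set Fs. full_schreier n G) \<and> sorted_wrt set_less Fs \<and>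
       length Fs = Min F)"

lemma full_schreier_in_schreier: "full_schreier n F \<Longrightarrow> F \<in> schreier n \<and> F \<noteq> {}"
proof (induction n arbitrary: F)
  case (Suc n)
  then obtain Fs where Fs: "F = \<Union>(set Fs)" "F \<noteq> {}" "\<forall>G\<in>set Fs. full_schreier n G"
    "sorted_wrt set_less Fs" "length Fs = Min F" unfolding full_schreier.simps by blast
  have sub: "set Fs \<subseteq> schreier n" using Suc.IH Fs(3) by blast
  then have "finite F" using Fs(1) schreier_finite by auto
  then have "\<forall>m\<in>F. length Fs \<le> m" using Fs(5) by simp
  then show ?case using Fs sub schreier_Suc_iff[of F n] by blast
qed auto

lemma full_schreier_finite: "full_schreier n F \<Longrightarrow> finite F"
  and full_schreier_nonempty: "full_schreier n F \<Longrightarrow> F \<noteq> {}"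
  and full_schreier_subset: "full_schreier n F \<Longrightarrow> F \<subseteq> {1..}"
  using full_schreier_in_schreier schreier_finite schreier_subset by blast+

text \<open>The decomposition \<open>Gs\<close> into full pieces is the greedy one. Against any
  decomposition \<open>Fs\<close> of the larger set, the first \<open>i\<close> pieces of
  \<open>Fs\<close> never get beyond the first \<open>i\<close> pieces of \<open>Gs\<close>: the
  first piece to do so would contain a full set of order one less together with a later point.
  Membership allows \<open>Fs\<close> at most \<open>Min G = length Gs\<close> pieces, so
  \<open>m\<close> is never covered.\<close>

lemma full_schreier_not_extendable:
  assumes "full_schreier n G" "\<forall>g\<in>G. g < m"
  shows "insert m G \<notin> schreier n"
  using assms
proof (induction n arbitrary: G m)
  case 0
  then show ?case by (auto simp: doubleton_eq_iff)
next
  case (Suc n)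
  obtain Gs where Gs: "G = \<Union>(set Gs)" "G \<noteq> {}" "\<forall>H\<in>set Gs. full_schreier n H"
    "sorted_wrt set_less Gs" "length Gs = Min G" using Suc.prems(1) unfolding full_schreier.simps by blast
  have UGs: "G = (\<Union>l<length Gs. Gs ! l)" using Gs(1) by (simp only: Union_set_nth)
  have finG: "finite G" using full_schreier_finite Suc.prems by blast
  show ?case
  proof
    assume "insert m G \<in> schreier (Suc n)"
    then obtain Fs where Fs: "insert m G = \<Union>(set Fs)" "set Fs \<subseteq> schreier n" "sorted_wrt set_less Fs"
      "\<forall>i\<in>insert m G. length Fs \<le> i" by (metis schreier_Suc_iff)
    have UFs: "insert m G = (\<Union>l<length Fs. Fs ! l)" using Fs(1) by (simp only: Union_set_nth)
    have len: "length Fs \<le> length Gs" using Fs(4) Gs(2,5) finG by auto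
    have "i \<le> length Fs \<Longrightarrow> (\<Union>l<i. Fs ! l) \<subseteq> (\<Union>l<i. Gs ! l)" for i
    proof (induction i)
      case (Suc i)
      have i: "i < length Fs" "i < length Gs" using Suc.prems len by auto
      have IH: "(\<Union>l<i. Fs ! l) \<subseteq> (\<Union>l<i. Gs ! l)" using Suc by auto
      show ?case
      proof (rule ccontr)
        assume "\<not> ?thesis"
        then obtain y where y: "y \<in> Fs ! i" "y \<notin> (\<Union>l<Suc i. Gs ! l)"
          using IH unfolding lessThan_Suc by blast
        \<comment> \<open>The overshooting point \<open>y\<close> is either \<open>m\<close> or lies
          in a piece of \<open>Gs\<close> after the \<open>i\<close>-th one; both lie beyond
          \<open>Gs ! i\<close>.\<close>
        have yG: "g < y" if g: "g \<in> Gs ! i" for g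
        proof -
          have "y \<in> insert m G" using y(1) i Fs(1) by (metis UnionI nth_mem)
          moreover have "g \<in> G" using g i Gs(1) by (metis UnionI nth_mem)
          moreover have "g < y" if yinG: "y \<in> G"
          proof -
            obtain l where l: "l < length Gs" "y \<in> Gs ! l" using yinG UGs by blast
            then have "\<not> l < Suc i" using y(2) by blast
            then have "i < l" by simp
            then have "set_less (Gs ! i) (Gs ! l)" using Gs(4) l by (auto simp: sorted_wrt_iff_nth_less)
            then show ?thesis using g l by (auto simp: set_less_def)
          qed
          ultimately show ?thesis using Suc.prems \<open>\<forall>g\<in>G. g < m\<close> by auto
        qed
        \<comment> \<open>No point of \<open>Gs ! i\<close> can sit elsewhere in \<open>Fs\<close>:
          earlier pieces of \<open>Fs\<close> are confined to earlier pieces of \<open>Gs\<close>,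
          and later ones lie beyond \<open>y\<close>.\<close>
        have "Gs ! i \<subseteq> Fs ! i"
        proof
          fix g assume g: "g \<in> Gs ! i"
          then have "g \<in> insert m G" using i Gs(1) by (metis UnionI insertCI nth_mem)
          then obtain l where l: "l < length Fs" "g \<in> Fs ! l" using UFs by blast
          have "\<not> l < i"
          proof
            assume "l < i"
            then obtain l' where "l' < i" "g \<in> Gs ! l'" using IH l by blast
            moreover have "set_less (Gs ! l') (Gs ! i)"
              using Gs(4) \<open>l' < i\<close> i by (auto simp: sorted_wrt_iff_nth_less)
            ultimately show False using g by (auto simp: set_less_def)
          qed
          moreover have "\<not> i < l"
          proof
            assume "i < l"
            then have "set_less (Fs ! i) (Fs ! l)" using Fs(3) l by (auto simp: sorted_wrt_iff_nth_less)
            then have "y < g" using y l by (auto simp: set_less_def)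
            then show False using yG g by fastforce
          qed
          ultimately show "g \<in> Fs ! i" using l by (simp add: linorder_neq_iff)
        qed
        then have "insert y (Gs ! i) \<subseteq> Fs ! i" using y by auto
        then have "insert y (Gs ! i) \<in> schreier n"
          using Fs(2) i schreier_hereditary by (metis nth_mem subsetD)
        then show False using \<open>\<And>G m. full_schreier n G \<Longrightarrow> \<forall>g\<in>G. g < m \<Longrightarrow> insert m G \<notin> schreier n\<close>
          yG Gs(3) i by (metis nth_mem)
      qed
    qed simp
    from this[of "length Fs"] have "(\<Union>l<length Fs. Fs ! l) \<subseteq> (\<Union>l<length Fs. Gs ! l)" by simp
    also have "\<dots> \<subseteq> (\<Union>l<length Gs. Gs ! l)" using len by (intro UN_mono) auto
    finally have "insert m G \<subseteq> G" using UFs UGs by simp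
    then show False using Suc.prems(2) by blast
  qed
qed

definition initial_part :: "nat set \<Rightarrow> nat set \<Rightarrow> bool" where
  "initial_part G L \<longleftrightarrow> G \<subseteq> L \<and> (\<forall>y\<in>L. \<forall>g\<in>G. y < g \<longrightarrow> y \<in> G)"

lemma infinite_above:
  assumes "infinite (L :: nat set)" "finite G"
  shows "infinite {y \<in> L. \<forall>g\<in>G. g < y}"
proof -
  have "L \<subseteq> {y \<in> L. \<forall>g\<in>G. g < y} \<union> (\<Union>g\<in>G. {..g})" by (auto simp: not_less)
  then show ?thesis using assms by (metis finite_UN finite_Un finite_atMost infinite_super)
qed

text \<open>Greedy construction: full sets of order one less are cut off the front of
  \<open>L\<close> one after another. What remains is always infinite, so the required number of
  pieces is reached.\<close>

lemma full_schreier_initial_exists: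
  assumes "infinite L" "L \<subseteq> {1..}"
  shows "\<exists>G. full_schreier n G \<and> initial_part G L"
  using assms
proof (induction n arbitrary: L)
  case 0
  then have ne: "L \<noteq> {}" by auto
  have L: "Inf L \<in> L" using ne by (rule Inf_nat_def1)
  have "y \<ge> Inf L" if "y \<in> L" for y using that by (simp add: wellorder_Inf_le1)
  then show ?case
    using L 0 by (intro exI[of _ "{Inf L}"]) (force simp: initial_part_def)
next
  case (Suc n)
  \<comment> \<open>The number \<open>r\<close> of pieces is left free for the induction and is set
    to \<open>Inf L\<close> afterwards, which is then also the minimum of the union.\<close>
  have "\<exists>Fs. length Fs = r \<and> (\<forall>G\<in>set Fs. full_schreier n G) \<and> sorted_wrt set_less Fs \<and>
    initial_part (\<Union>(set Fs)) L" for r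
  proof (induction r)
    case 0
    then show ?case by (auto simp: initial_part_def)
  next
    case (Suc r)
    then obtain Fs where Fs: "length Fs = r" "\<forall>G\<in>set Fs. full_schreier n G" "sorted_wrt set_less Fs"
      "initial_part (\<Union>(set Fs)) L" by auto
    define L' where "L' = {y \<in> L. \<forall>g\<in>\<Union>(set Fs). g < y}"
    have "finite (\<Union>(set Fs))" using Fs(2) full_schreier_finite by auto
    then have "infinite L'" "L' \<subseteq> {1..}"
      using infinite_above[OF \<open>infinite L\<close>] \<open>L \<subseteq> {1..}\<close> unfolding L'_def by blast+
    then obtain G where G: "full_schreier n G" "initial_part G L'"
      using \<open>\<And>L. infinite L \<Longrightarrow> L \<subseteq> {1..} \<Longrightarrow> \<exists>G. full_schreier n G \<and> initial_part G L\<close> by blast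
    have sub: "G \<subseteq> L'" using G by (auto simp: initial_part_def)
    have "y \<in> \<Union>(set (Fs @ [G]))" if y: "y \<in> L" "g \<in> \<Union>(set (Fs @ [G]))" "y < g" for y g
    proof (cases "g \<in> G")
      case True
      show ?thesis
      proof (cases "y \<in> L'")
        case True
        then show ?thesis using G(2) y \<open>g \<in> G\<close> by (auto simp: initial_part_def)
      next
        case False
        then obtain f where f: "f \<in> \<Union>(set Fs)" "y \<le> f" using y by (force simp: L'_def)
        then have "y \<in> \<Union>(set Fs)" using Fs(4) y(1) unfolding initial_part_def
          by (metis le_neq_implies_less)
        then show ?thesis by auto
      qed
    next
      case False
      then have "y \<in> \<Union>(set Fs)" using y Fs(4) unfolding initial_part_def by auto
      then show ?thesis by auto
    qed
    then have "initial_part (\<Union>(set (Fs @ [G]))) L"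
      using Fs(4) sub unfolding initial_part_def by (auto simp: L'_def)
    moreover have "sorted_wrt set_less (Fs @ [G])"
      using Fs(3) sub by (auto simp: sorted_wrt_append set_less_def L'_def)
    ultimately show ?case using Fs G by (intro exI[of _ "Fs @ [G]"]) auto
  qed
  then obtain Fs where Fs: "length Fs = Inf L" "\<forall>G\<in>set Fs. full_schreier n G" "sorted_wrt set_less Fs"
    "initial_part (\<Union>(set Fs)) L" by blast
  let ?F = "\<Union>(set Fs)"
  have "L \<noteq> {}" using Suc.prems by auto
  then have L: "Inf L \<in> L" by (rule Inf_nat_def1)
  then have "Fs \<noteq> []" using Suc.prems Fs(1) by auto
  then have ne: "?F \<noteq> {}" using Fs(2) full_schreier_nonempty
    by (metis Sup_bot_conv(1) list.set_intros(1) list.exhaust)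
  have fin: "finite ?F" using Fs(2) full_schreier_finite by auto
  have ge: "y \<ge> Inf L" if "y \<in> L" for y using that by (simp add: wellorder_Inf_le1)
  have "Inf L \<in> ?F" using Fs(4) L ne ge unfolding initial_part_def
    by (metis ex_in_conv order_le_less subsetD)
  then have "Min ?F = Inf L"
    using fin ge Fs(4) by (intro Min_eqI) (auto simp: initial_part_def)
  then have "full_schreier (Suc n) ?F"
    unfolding full_schreier.simps using Fs(1-3) ne by (intro exI[of _ Fs]) simp
  then show ?case using Fs(4) by blast
qed

text \<open>A full set \<open>G\<close> is compared with \<open>F\<close> inside a set of which both
  are initial parts. If \<open>G\<close> stopped before exhausting \<open>F\<close>, then
  \<open>G\<close> with one further point of \<open>F\<close> would be a subset of \<open>F\<close>,
  hence a Schreier set, although full sets are not extendable. So \<open>F \<subseteq> G\<close>,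
  and maximality gives equality.\<close>

lemma maximal_schreier_full:
  assumes "maximal_schreier n F"
  shows "full_schreier n F"
proof -
  have F: "F \<in> schreier n" "\<And>G. G \<in> schreier n \<Longrightarrow> F \<subseteq> G \<Longrightarrow> G = F"
    using assms by (auto simp: maximal_schreier_def)
  \<comment> \<open>All integers beyond \<open>F\<close> are appended only to obtain an infinite set
    to which the greedy construction applies.\<close>
  define L where "L = F \<union> {y \<in> {1..}. \<forall>f\<in>F. f < y}"
  have fin: "finite F" using F schreier_finite by auto
  have "infinite L" "L \<subseteq> {1..}"
    using infinite_above[OF infinite_Ici fin, of 1] schreier_subset[OF F(1)] by (auto simp: L_def)
  then obtain G where G: "full_schreier n G" "initial_part G L"
    using full_schreier_initial_exists by blast
  have "F \<subseteq> G"
  proof (rule ccontr)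
    assume "\<not> F \<subseteq> G"
    then obtain f where f: "f \<in> F" "f \<notin> G" by auto
    have lt: "g < f" if "g \<in> G" for g
    proof -
      have "f \<in> L" using f by (simp add: L_def)
      then have "\<not> f < g" using G(2) that f(2) unfolding initial_part_def by blast
      moreover have "f \<noteq> g" using that f(2) by auto
      ultimately show ?thesis by simp
    qed
    have "g \<in> F" if "g \<in> G" for g
    proof -
      have "g \<in> L" using G(2) that by (auto simp: initial_part_def)
      moreover have "\<not> (\<forall>f\<in>F. f < g)" using lt[OF that] f(1) by (auto intro: less_asym)
      ultimately show ?thesis by (simp add: L_def)
    qed
    then have "insert f G \<subseteq> F" using f by auto
    then show False
      using full_schreier_not_extendable[OF G(1), of f] lt schreier_hereditary[OF F(1)] by blast
  qed
  then have "G = F" using F full_schreier_in_schreier[OF G(1)] by blast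
  then show ?thesis using G by simp
qed

subsection \<open>Repeated averages\<close>

lemma sum_UN_le:
  fixes f :: "'b \<Rightarrow> real"
  assumes "finite I" "\<And>i. i \<in> I \<Longrightarrow> finite (B i)" "\<And>i b. i \<in> I \<Longrightarrow> b \<in> B i \<Longrightarrow> 0 \<le> f b"
  shows "sum f (\<Union>i\<in>I. B i) \<le> (\<Sum>i\<in>I. sum f (B i))"
  using assms
proof (induction I rule: finite_induct)
  case (insert j I)
  have "sum f (\<Union>i\<in>insert j I. B i) \<le> sum f (B j) + sum f (\<Union>i\<in>I. B i)"
  proof -
    have "0 \<le> sum f (B j \<inter> (\<Union>i\<in>I. B i))" using insert.prems by (intro sum_nonneg) auto
    moreover have "finite (B j)" "finite (\<Union>i\<in>I. B i)" using insert by auto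
    ultimately show ?thesis by (simp add: sum_Un)
  qed
  also have "\<dots> \<le> sum f (B j) + (\<Sum>i\<in>I. sum f (B i))" using insert by auto
  finally show ?case using insert by simp
qed simp

text \<open>The minima of successive full sets at least double from one set to the next.\<close>

lemma full_schreier_inverse_Min_sum:
  assumes "sorted_wrt set_less Gs" "\<forall>G\<in>set Gs. full_schreier (Suc m) G"
    "1 \<le> M" "\<forall>G\<in>set Gs. \<forall>i\<in>G. M \<le> i"
  shows "(\<Sum>G\<leftarrow>Gs. 1 / real (Min G)) \<le> 2 / real M"
  using assms
proof (induction Gs arbitrary: M)
  case (Cons G Gs)
  have full: "full_schreier (Suc m) G" using Cons.prems by simp
  then have G: "finite G" "G \<noteq> {}"
    using full_schreier_finite full_schreier_nonempty by blast+
  have M: "M \<le> Min G" using G Cons.prems by simp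
  obtain Fs where Fs: "G = \<Union>(set Fs)" "\<forall>H\<in>set Fs. full_schreier m H" "sorted_wrt set_less Fs"
    "length Fs = Min G" using full unfolding full_schreier.simps by blast
  \<comment> \<open>\<open>G\<close> consists of \<open>Min G\<close> successive nonempty pieces, so
    anything after it is at least \<open>2 * Min G\<close>. The bound then reproduces itself:
    \<open>1 / Min G + 2 / (2 * Min G) = 2 / Min G\<close>.\<close>
  have "(\<Sum>G\<leftarrow>Gs. 1 / real (Min G)) \<le> 2 / real (2 * Min G)"
  proof (rule Cons.IH)
    show "\<forall>H\<in>set Gs. \<forall>i\<in>H. 2 * Min G \<le> i"
    proof (intro ballI)
      fix H i assume "H \<in> set Gs" "i \<in> H"
      then have lt: "g < i" if "g \<in> G" for g
        using Cons.prems(1) that by (auto simp: set_less_def)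
      have "Min G + length Fs \<le> i"
      proof (rule sorted_sets_length[OF Fs(3)])
        show "{} \<notin> set Fs" using Fs(2) full_schreier_nonempty by blast
        show "\<forall>k\<in>\<Union>(set Fs). Min G \<le> k \<and> k < i" using lt G unfolding Fs(1)[symmetric] by simp
        show "Min G \<le> i" using lt[of "Min G"] G by simp
      qed
      then show "2 * Min G \<le> i" using Fs(4) by simp
    qed
  qed (use Cons.prems M in auto)
  then have "(\<Sum>G\<leftarrow>G # Gs. 1 / real (Min G)) \<le> 2 / real (Min G)" by simp
  also have "\<dots> \<le> 2 / real M" using M Cons.prems(3) by (intro divide_left_mono) auto
  finally show ?case .
qed simp

text \<open>The bounds by powers of \<open>Max F\<close> and \<open>Min F\<close> make the average stay decreasing when the averages of
  successive pieces are glued together.\<close>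

definition schreier_average :: "nat \<Rightarrow> nat set \<Rightarrow> (nat \<Rightarrow> real) \<Rightarrow> bool" where
  "schreier_average n F \<alpha> \<longleftrightarrow>
     (\<forall>i\<in>F. 0 < \<alpha> i) \<and> sum \<alpha> F = 1 \<and> (\<forall>i\<in>F. \<forall>j\<in>F. i \<le> j \<longrightarrow> \<alpha> j \<le> \<alpha> i) \<and>
     (\<forall>i\<in>F. 1 / real (Max F) ^ n \<le> \<alpha> i \<and> \<alpha> i \<le> 1 / real (Min F) ^ n) \<and>
     (\<forall>m. n = Suc m \<longrightarrow> (\<forall>H\<in>schreier m. H \<subseteq> F \<longrightarrow> sum \<alpha> H \<le> (2 ^ n - 1) / real (Min F)))"

text \<open>The average on \<open>F\<close> is the mean of the averages on its
  \<open>q = Min F\<close> full pieces. For smallness on \<open>H\<close>, let \<open>G0\<close> be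
  the piece containing \<open>h = Min H\<close>. Before division by \<open>q\<close>, pieces
  preceding \<open>G0\<close> contribute nothing and \<open>G0\<close> at most \<open>1\<close>. On
  a later piece \<open>G\<close>, the set \<open>H\<close> splits into at most \<open>h\<close> sets
  of order one less, each of mass at most \<open>(2 ^ n - 1) / Min G\<close>. The reciprocals of
  these minima add up to at most \<open>2 / h\<close>, so the later pieces give at most
  \<open>2 * (2 ^ n - 1)\<close>. The recursion \<open>c' = 1 + 2 * c\<close> from \<open>1\<close>
  to \<open>n\<close>-th order explains the constant \<open>2 ^ n - 1\<close>.\<close>

lemma schreier_average_exists:
  assumes "full_schreier n F"
  shows "\<exists>\<alpha>. schreier_average n F \<alpha>"
  using assms
proof (induction n arbitrary: F)
  case 0
  then obtain m where "F = {m}" by auto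
  then show ?case by (intro exI[of _ "\<lambda>_. 1"]) (auto simp: schreier_average_def)
next
  case (Suc n)
  obtain Fs where Fs: "F = \<Union>(set Fs)" "F \<noteq> {}" "\<forall>G\<in>set Fs. full_schreier n G"
    "sorted_wrt set_less Fs" "length Fs = Min F"
    using Suc.prems unfolding full_schreier.simps by blast
  have finF: "finite F" "F \<subseteq> {1..}"
    using full_schreier_finite full_schreier_subset Suc.prems by blast+
  define q where "q = Min F"
  have "q \<in> F" using finF Fs(2) by (simp add: q_def)
  then have q: "1 \<le> q" "q \<le> Max F" using finF by auto
  have G: "finite G" "G \<noteq> {}" "G \<subseteq> F" "q \<le> Min G" "Max G \<le> Max F" "1 \<le> Max G"
    if "G \<in> set Fs" for G
  proof -
    show *: "finite G" "G \<noteq> {}" "G \<subseteq> F"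
      using that Fs(1,3) full_schreier_finite full_schreier_nonempty by blast+
    show "q \<le> Min G" "Max G \<le> Max F"
      using * finF Min_antimono Max_mono by (auto simp: q_def)
    show "1 \<le> Max G" using * finF by (meson Max_in atLeast_iff subsetD)
  qed
  have dist: "distinct Fs" using sorted_sets_distinct[OF Fs(4)] G(2) by blast
  then have card: "card (set Fs) = q" using Fs(5) by (simp add: distinct_card q_def)
  have less: "set_less G H \<or> set_less H G" if "G \<in> set Fs" "H \<in> set Fs" "G \<noteq> H" for G H
    using sorted_sets_cases[OF Fs(4)] that by blast
  have disj: "G = H" if "G \<in> set Fs" "H \<in> set Fs" "i \<in> G" "i \<in> H" for G H i
    using less that by (auto simp: set_less_def)
  obtain A where A: "\<And>G. G \<in> set Fs \<Longrightarrow> schreier_average n G (A G)"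
    using Suc.IH Fs(3) by metis
  define \<alpha> where "\<alpha> i = A (THE G. G \<in> set Fs \<and> i \<in> G) i / q" for i
  have \<alpha>: "\<alpha> i = A G i / q" if "G \<in> set Fs" "i \<in> G" for G i
  proof -
    have "(THE G. G \<in> set Fs \<and> i \<in> G) = G" using that disj by (intro the_equality) blast+
    then show ?thesis by (simp add: \<alpha>_def)
  qed
  have pos: "\<forall>i\<in>F. 0 < \<alpha> i"
    using A \<alpha> q unfolding Fs(1) by (auto simp: schreier_average_def)
  have split: "sum \<alpha> H = (\<Sum>G\<in>set Fs. sum (A G) (H \<inter> G)) / q" if "H \<subseteq> F" for H
  proof -
    have "H = (\<Union>G\<in>set Fs. H \<inter> G)" using that Fs(1) by auto
    then have "sum \<alpha> H = sum \<alpha> (\<Union>G\<in>set Fs. H \<inter> G)" by simp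
    also have "\<dots> = (\<Sum>G\<in>set Fs. sum \<alpha> (H \<inter> G))"
      using G(1) disj by (intro sum.UNION_disjoint) auto
    also have "\<dots> = (\<Sum>G\<in>set Fs. sum (A G) (H \<inter> G) / q)"
      by (intro sum.cong refl) (auto simp: \<alpha> sum_divide_distrib intro!: sum.cong)
    finally show ?thesis by (simp add: sum_divide_distrib)
  qed
  have "(\<Sum>G\<in>set Fs. sum (A G) (F \<inter> G)) = (\<Sum>G\<in>set Fs. 1)"
    using A G(3) by (intro sum.cong) (auto simp: schreier_average_def Int_absorb1)
  then have sum1: "sum \<alpha> F = 1" using split[of F] card q by simp
  have anti: "\<alpha> j \<le> \<alpha> i" if ij: "i \<in> F" "j \<in> F" "i \<le> j" for i j
  proof -
    obtain G H where GH: "G \<in> set Fs" "i \<in> G" "H \<in> set Fs" "j \<in> H" using ij Fs(1) by blast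
    show ?thesis
    proof (cases "G = H")
      case True
      then show ?thesis using A[OF GH(1)] GH ij(3) q
        by (auto simp: \<alpha>[of G] schreier_average_def divide_right_mono)
    next
      case False
      then have "set_less G H" using less[OF GH(1,3)] GH ij(3) by (force simp: set_less_def)
      then have "Max G < Min H" using G[OF GH(1)] G[OF GH(3)] by (auto simp: set_less_def)
      then have "1 / real (Min H) ^ n \<le> 1 / real (Max G) ^ n"
        using G(6)[OF GH(1)] by (intro divide_left_mono power_mono) auto
      moreover have "A H j \<le> 1 / real (Min H) ^ n" "1 / real (Max G) ^ n \<le> A G i"
        using A GH by (auto simp: schreier_average_def)
      ultimately have "A H j \<le> A G i" by linarith
      then show ?thesis using GH by (simp add: \<alpha>[of G] \<alpha>[of H] divide_right_mono)
    qed
  qed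
  have bounds: "1 / real (Max F) ^ Suc n \<le> \<alpha> i \<and> \<alpha> i \<le> 1 / real (Min F) ^ Suc n" if "i \<in> F" for i
  proof -
    obtain H where H: "H \<in> set Fs" "i \<in> H" using \<open>i \<in> F\<close> Fs(1) by blast
    have "A H i \<le> 1 / real (Min H) ^ n" using A H by (auto simp: schreier_average_def)
    also have "\<dots> \<le> 1 / real q ^ n"
      using G(4)[OF H(1)] q by (intro divide_left_mono power_mono) auto
    finally have 1: "A H i / q \<le> 1 / real q ^ n / q" using q by (intro divide_right_mono) auto
    have "1 / real (Max F) ^ n \<le> 1 / real (Max H) ^ n"
      using G(5,6)[OF H(1)] by (intro divide_left_mono power_mono) auto
    also have "\<dots> \<le> A H i" using A H by (auto simp: schreier_average_def)
    finally have "1 / real (Max F) ^ n / Max F \<le> A H i / q"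
      using q A[OF H(1)] H(2) by (intro frac_le) (auto simp: schreier_average_def less_imp_le)
    then show ?thesis using 1 by (simp add: \<alpha>[OF H] q_def mult.commute)
  qed
  have small: "sum \<alpha> H \<le> (2 ^ Suc n - 1) / real (Min F)" if H: "H \<in> schreier n" "H \<subseteq> F" for H
  proof (cases "H = {}")
    case True
    have "(1::real) \<le> 2 ^ Suc n" by (rule one_le_power) simp
    then show ?thesis using True by simp
  next
    case False
    have finH: "finite H" using H schreier_finite by blast
    define h where "h = Min H"
    have h: "h \<in> H" "\<And>i. i \<in> H \<Longrightarrow> h \<le> i" using finH False by (auto simp: h_def)
    obtain G0 where G0: "G0 \<in> set Fs" "h \<in> G0" using h(1) H(2) Fs(1) by blast
    define Gs where "Gs = filter (set_less G0) Fs"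
    have zero: "H \<inter> G = {}" if "G \<in> set Fs" "G \<noteq> G0" "G \<notin> set Gs" for G
    proof -
      have "set_less G G0" using less[OF G0(1) that(1)] that by (auto simp: Gs_def)
      then show ?thesis using G0 h(2) by (force simp: set_less_def)
    qed
    have G0n: "G0 \<notin> set Gs" using G0 by (auto simp: Gs_def set_less_def)
    have "(\<Sum>G\<in>set Fs. sum (A G) (H \<inter> G)) = (\<Sum>G\<in>insert G0 (set Gs). sum (A G) (H \<inter> G))"
      using zero G0 by (intro sum.mono_neutral_right) (auto simp: Gs_def)
    also have "\<dots> = sum (A G0) (H \<inter> G0) + (\<Sum>G\<in>set Gs. sum (A G) (H \<inter> G))"
      using G0n by simp
    also have "\<dots> \<le> 1 + (2 ^ Suc n - 2)"
    proof (rule add_mono)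
      have "sum (A G0) (H \<inter> G0) \<le> sum (A G0) G0"
        using A[OF G0(1)] G[OF G0(1)] by (intro sum_mono2) (auto simp: schreier_average_def less_imp_le)
      then show "sum (A G0) (H \<inter> G0) \<le> 1" using A[OF G0(1)] by (simp add: schreier_average_def)
    next
      show "(\<Sum>G\<in>set Gs. sum (A G) (H \<inter> G)) \<le> 2 ^ Suc n - 2"
      proof (cases n)
        case 0
        \<comment> \<open>In order zero there is no decomposition to use, but \<open>H\<close> is a
          single point and misses all later pieces, in agreement with
          \<open>2 ^ Suc 0 - 2 = 0\<close>.\<close>
        then have "H = {h}" using H(1) h(1) by auto
        then have "H \<inter> G = {}" if "G \<in> set Gs" for G
          using that G0 by (auto simp: Gs_def set_less_def)
        then show ?thesis using 0 by simp
      next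
        case (Suc m)
        then obtain Hs where Hs: "H = \<Union>(set Hs)" "set Hs \<subseteq> schreier m" "sorted_wrt set_less Hs"
          "\<forall>i\<in>H. length Hs \<le> i" using H(1) by (metis schreier_Suc_iff)
        have lenHs: "card (set Hs) \<le> h" using Hs(4) h(1) card_length[of Hs] by fastforce
        have h1: "1 \<le> h" using h(1) H(2) finF(2) by auto
        have C0: "(0::real) \<le> 2 ^ n - 1" by simp
        have each: "sum (A G) (H \<inter> G) \<le> h * (2 ^ n - 1) * (1 / Min G)" if "G \<in> set Gs" for G
        proof -
          have GF: "G \<in> set Fs" using that by (simp add: Gs_def)
          have "sum (A G) (H \<inter> G) = sum (A G) (\<Union>H'\<in>set Hs. H' \<inter> G)"
            unfolding Hs(1) by (rule arg_cong) auto
          also have "\<dots> \<le> (\<Sum>H'\<in>set Hs. sum (A G) (H' \<inter> G))"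
            using A[OF GF] G(1)[OF GF] by (intro sum_UN_le) (auto simp: schreier_average_def less_imp_le)
          also have "\<dots> \<le> (\<Sum>H'\<in>set Hs. (2 ^ n - 1) / Min G)"
          proof (rule sum_mono)
            fix H' assume "H' \<in> set Hs"
            then have "H' \<inter> G \<in> schreier m" using Hs(2) schreier_hereditary by blast
            then show "sum (A G) (H' \<inter> G) \<le> (2 ^ n - 1) / Min G"
              using A[OF GF] Suc unfolding schreier_average_def by blast
          qed
          also have "\<dots> = card (set Hs) * ((2 ^ n - 1) / Min G)" by simp
          also have "\<dots> \<le> h * ((2 ^ n - 1) / Min G)" using lenHs C0 by (intro mult_right_mono) auto
          finally show ?thesis by simp
        qed
        have "(\<Sum>G\<leftarrow>Gs. 1 / real (Min G)) \<le> 2 / real h"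
        proof (rule full_schreier_inverse_Min_sum)
          show "sorted_wrt set_less Gs" using Fs(4) by (simp add: Gs_def sorted_wrt_filter)
          show "\<forall>G\<in>set Gs. full_schreier (Suc m) G" using Fs(3) Suc by (auto simp: Gs_def)
          show "\<forall>G\<in>set Gs. \<forall>i\<in>G. h \<le> i" using G0 by (auto simp: Gs_def set_less_def less_imp_le)
        qed (rule h1)
        moreover have "distinct Gs" using dist by (simp add: Gs_def)
        ultimately have inv: "(\<Sum>G\<in>set Gs. 1 / real (Min G)) \<le> 2 / real h"
          by (simp add: sum_list_distinct_conv_sum_set)
        have "(\<Sum>G\<in>set Gs. sum (A G) (H \<inter> G)) \<le> (\<Sum>G\<in>set Gs. h * (2 ^ n - 1) * (1 / Min G))"
          by (rule sum_mono) (rule each)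
        also have "\<dots> = h * (2 ^ n - 1) * (\<Sum>G\<in>set Gs. 1 / real (Min G))" by (simp add: sum_distrib_left)
        also have "\<dots> \<le> h * (2 ^ n - 1) * (2 / real h)" using inv C0 by (intro mult_left_mono) auto
        also have "\<dots> = 2 ^ Suc n - 2" using h1 by simp
        finally show ?thesis .
      qed
    qed
    finally have "(\<Sum>G\<in>set Fs. sum (A G) (H \<inter> G)) \<le> 2 ^ Suc n - 1" by simp
    then show ?thesis
      unfolding split[OF H(2)] q_def[symmetric] by (rule divide_right_mono) simp
  qed
  show ?case
    using pos sum1 anti bounds small unfolding schreier_average_def by (intro exI[of _ \<alpha>]) blast
qed

subsection \<open>Schreier norms\<close>

text \<open>The factor \<open>(-1) ^ l\<close> makes the leading term positive. Writing
  \<open>S l\<close> for the signed sum, \<open>S l = a l - S (Suc l)\<close>; the upper bound needs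
  the lower bound of the shorter sum and conversely, so both are carried through the
  induction.\<close>

lemma alternating_sum_bound:
  fixes a :: "nat \<Rightarrow> real"
  assumes "\<And>i. i \<in> {l..l + d} \<Longrightarrow> 0 \<le> a i" "\<And>i j. i \<in> {l..l + d} \<Longrightarrow> j \<in> {l..l + d} \<Longrightarrow> i \<le> j \<Longrightarrow> a j \<le> a i"
  shows "0 \<le> (-1) ^ l * (\<Sum>i=l..l+d. (-1) ^ i * a i) \<and> (-1) ^ l * (\<Sum>i=l..l+d. (-1) ^ i * a i) \<le> a l"
  using assms
proof (induction d arbitrary: l)
  case (Suc d)
  have sq: "(-1 :: real) ^ l * (-1) ^ l = 1" by (simp flip: power_mult_distrib)
  have "(\<Sum>i=l..l+Suc d. (-1) ^ i * a i) = (-1) ^ l * a l + (\<Sum>i=Suc l..Suc l + d. (-1) ^ i * a i)"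
    by (subst sum.atLeast_Suc_atMost) auto
  then have eq: "(-1) ^ l * (\<Sum>i=l..l+Suc d. (-1) ^ i * a i)
      = a l - (-1) ^ Suc l * (\<Sum>i=Suc l..Suc l + d. (-1) ^ i * a i)"
    using sq by (simp only: distrib_left mult.assoc[symmetric]) simp
  have "0 \<le> (-1) ^ Suc l * (\<Sum>i=Suc l..Suc l + d. (-1) ^ i * a i) \<and>
      (-1) ^ Suc l * (\<Sum>i=Suc l..Suc l + d. (-1) ^ i * a i) \<le> a (Suc l)"
    by (rule Suc.IH; rule Suc.prems) auto
  moreover have "a (Suc l) \<le> a l" by (rule Suc.prems(2)) auto
  ultimately show ?case unfolding eq by linarith
qed simp

lemma interval_alternating_sum_bound:
  fixes a :: "nat \<Rightarrow> real"
  assumes I: "finite I" "I \<noteq> {}" "\<And>i j. i \<in> I \<Longrightarrow> j \<in> I \<Longrightarrow> {i..j} \<subseteq> I"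
    and a: "\<And>i. i \<in> I \<Longrightarrow> 0 \<le> a i" "\<And>i j. i \<in> I \<Longrightarrow> j \<in> I \<Longrightarrow> i \<le> j \<Longrightarrow> a j \<le> a i"
  shows "\<bar>\<Sum>i\<in>I. (-1) ^ i * a i\<bar> \<le> a (Min I)"
proof -
  have mem: "Min I \<in> I" "Max I \<in> I" and le: "Min I \<le> Max I" using I(1,2) by auto
  have "I = {Min I..Max I}" using I(1) I(3)[OF mem] by (intro equalityI) auto
  then have eq: "I = {Min I..Min I + (Max I - Min I)}" using le by simp
  have "\<bar>\<Sum>i\<in>I. (-1) ^ i * a i\<bar> = \<bar>(-1) ^ Min I * (\<Sum>i=Min I..Min I + (Max I - Min I). (-1) ^ i * a i)\<bar>"
    using eq by (simp add: abs_mult power_abs)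
  also have "\<dots> \<le> a (Min I)"
    using alternating_sum_bound[of "Min I" "Max I - Min I" a] a eq by auto
  finally show ?thesis .
qed

lemma schreier_norm_ge:
  assumes "F \<in> schreier n" "finite {i. y i \<noteq> 0}"
  shows "(\<Sum>i\<in>F. \<bar>y i\<bar>) \<le> schreier_norm n y"
  unfolding schreier_norm_def
proof (rule cSUP_upper[OF assms(1)])
  show "bdd_above ((\<lambda>F. \<Sum>i\<in>F. \<bar>y i\<bar>) ` schreier n)"
  proof (rule bdd_aboveI2)
    fix G assume "G \<in> schreier n"
    then have "finite G" by (rule schreier_finite)
    then have "(\<Sum>i\<in>G. \<bar>y i\<bar>) = (\<Sum>i\<in>G \<inter> {i. y i \<noteq> 0}. \<bar>y i\<bar>)"
      by (intro sum.mono_neutral_right) auto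
    also have "\<dots> \<le> (\<Sum>i\<in>{i. y i \<noteq> 0}. \<bar>y i\<bar>)" using assms(2) by (intro sum_mono2) auto
    finally show "(\<Sum>i\<in>G. \<bar>y i\<bar>) \<le> (\<Sum>i\<in>{i. y i \<noteq> 0}. \<bar>y i\<bar>)" .
  qed
qed

lemma unit_vec_sum:
  assumes "inj_on t {1..p::nat}"
  shows "i \<in> {1..p} \<Longrightarrow> (\<Sum>l=1..p. a l * unit_vec (t l) (t i)) = a i"
    and "m \<notin> t ` {1..p} \<Longrightarrow> (\<Sum>l=1..p. a l * unit_vec (t l) m) = 0"
proof -
  assume i: "i \<in> {1..p}"
  have "(\<Sum>l=1..p. a l * unit_vec (t l) (t i)) = (\<Sum>l=1..p. if l = i then a i else 0)"
    using i by (intro sum.cong) (auto simp: unit_vec_def inj_on_eq_iff[OF assms])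
  then show "(\<Sum>l=1..p. a l * unit_vec (t l) (t i)) = a i" using i by simp
next
  assume "m \<notin> t ` {1..p}"
  then show "(\<Sum>l=1..p. a l * unit_vec (t l) m) = 0"
    by (intro sum.neutral) (auto simp: unit_vec_def)
qed

text \<open>An alternating decreasing sum over an interval is dominated by its first term, and the first
  terms form a spread of the minima of the intervals.\<close>

lemma cond_schreier_norm_alternating:
  assumes t: "strict_mono_on {1..p::nat} t"
    and \<alpha>: "\<And>m. m \<in> t ` {1..p} \<Longrightarrow> 0 < \<alpha> m"
      "\<And>l m. l \<in> t ` {1..p} \<Longrightarrow> m \<in> t ` {1..p} \<Longrightarrow> l \<le> m \<Longrightarrow> \<alpha> m \<le> \<alpha> l"
    and c: "\<And>G. G \<in> schreier k \<Longrightarrow> G \<subseteq> t ` {1..p} \<Longrightarrow> sum \<alpha> G \<le> c"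
  shows "cond_schreier_norm k (\<lambda>m. \<Sum>i=1..p. ((-1) ^ i * \<alpha> (t i)) * unit_vec (t i) m) \<le> c"
proof -
  define y where "y m = (\<Sum>i=1..p. ((-1) ^ i * \<alpha> (t i)) * unit_vec (t i) m)" for m
  have inj: "inj_on t {1..p}" using t by (rule strict_mono_on_imp_inj_on)
  have yt: "y (t i) = (-1) ^ i * \<alpha> (t i)" if "i \<in> {1..p}" for i
    unfolding y_def using unit_vec_sum(1)[OF inj that] .
  have y0: "y m = 0" if "m \<notin> t ` {1..p}" for m unfolding y_def using unit_vec_sum(2)[OF inj that] .
  have ynz: "y m \<noteq> 0 \<longleftrightarrow> m \<in> t ` {1..p}" for m
    using y0 yt \<alpha>(1) by fastforce
  have "cond_schreier_norm k y \<le> c"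
    unfolding cond_schreier_norm_def
  proof (rule cSup_least)
    \<comment> \<open>A least-upper-bound argument over the reals needs a nonempty set of
      candidates; the single interval \<open>{1}\<close> provides one.\<close>
    have "{1} \<in> schreier k" using schreier_mono[of 0 k] by auto
    moreover have "{Inf {1} | k. k \<in> {1..1::nat}} = {1::nat}" by auto
    ultimately show "{(\<Sum>k=1..n. \<bar>\<Sum>i\<in>{i\<in>J k. y i \<noteq> 0}. y i\<bar>) | (n :: nat) (J :: nat \<Rightarrow> nat set).
            1 \<le> n \<and> (\<forall>k\<in>{1..n}. nat_interval (J k)) \<and>
            (\<forall>k\<in>{1..n}. \<forall>l\<in>{1..n}. k < l \<longrightarrow> set_less (J k) (J l)) \<and>
            {Inf (J k) | k. k \<in> {1..n}} \<in> schreier k} \<noteq> {}"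
      unfolding ex_in_conv[symmetric]
      by (intro exI CollectI exI[of _ "1::nat"] exI[of _ "\<lambda>_. {1}"] conjI refl) (auto simp: nat_interval_def)
  next
    fix r
    assume "r \<in> {(\<Sum>k=1..n. \<bar>\<Sum>i\<in>{i\<in>J k. y i \<noteq> 0}. y i\<bar>) | (n :: nat) (J :: nat \<Rightarrow> nat set).
            1 \<le> n \<and> (\<forall>k\<in>{1..n}. nat_interval (J k)) \<and>
            (\<forall>k\<in>{1..n}. \<forall>l\<in>{1..n}. k < l \<longrightarrow> set_less (J k) (J l)) \<and>
            {Inf (J k) | k. k \<in> {1..n}} \<in> schreier k}"
    then obtain n :: nat and J :: "nat \<Rightarrow> nat set"
      where r: "r = (\<Sum>k=1..n. \<bar>\<Sum>i\<in>{i\<in>J k. y i \<noteq> 0}. y i\<bar>)"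
      and J': "\<forall>k\<in>{1..n}. nat_interval (J k)"
        "\<forall>k\<in>{1..n}. \<forall>l\<in>{1..n}. k < l \<longrightarrow> set_less (J k) (J l)"
      and infs: "{Inf (J k) | k. k \<in> {1..n}} \<in> schreier k"
      by (elim CollectE exE conjE) (rule that)
    note J = J'(1)[rule_format] J'(2)[rule_format]
    \<comment> \<open>\<open>I q\<close> pulls the interval \<open>J q\<close> back to positions.
      Since \<open>t\<close> is increasing, \<open>I q\<close> is an interval of positions, so the
      signs really alternate along it.\<close>
    define I where "I q = {i \<in> {1..p}. t i \<in> J q}" for q
    define Q where "Q = {q \<in> {1..n}. I q \<noteq> {}}"
    define g where "g q = t (Min (I q))" for q
    have finI: "finite (I q)" for q by (simp add: I_def)
    have inner: "(\<Sum>i\<in>{i\<in>J q. y i \<noteq> 0}. y i) = (\<Sum>i\<in>I q. (-1) ^ i * \<alpha> (t i))" for q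
    proof -
      have "{i\<in>J q. y i \<noteq> 0} = t ` I q" unfolding ynz I_def by auto
      moreover have "inj_on t (I q)" using inj by (rule inj_on_subset) (auto simp: I_def)
      ultimately have "(\<Sum>i\<in>{i\<in>J q. y i \<noteq> 0}. y i) = (\<Sum>i\<in>I q. y (t i))"
        by (simp add: sum.reindex)
      also have "\<dots> = (\<Sum>i\<in>I q. (-1) ^ i * \<alpha> (t i))" by (intro sum.cong) (auto simp: yt I_def)
      finally show ?thesis .
    qed
    have MinI: "Min (I q) \<in> I q" if "q \<in> Q" for q using that finI by (auto simp: Q_def)
    have gJ: "g q \<in> J q" "g q \<in> t ` {1..p}" if "q \<in> Q" for q
      using MinI[OF that] by (auto simp: g_def I_def)
    have first: "\<bar>\<Sum>i\<in>I q. (-1) ^ i * \<alpha> (t i)\<bar> \<le> \<alpha> (g q)" if q: "q \<in> Q" for q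
      unfolding g_def
    proof (rule interval_alternating_sum_bound[where a = "\<lambda>i. \<alpha> (t i)"])
      show "{i..j} \<subseteq> I q" if ij: "i \<in> I q" "j \<in> I q" for i j
      proof
        fix l assume l: "l \<in> {i..j}"
        then have lp: "l \<in> {1..p}" using ij by (auto simp: I_def)
        have "t i \<le> t l" "t l \<le> t j"
          using l lp ij strict_mono_on_leD[OF t] by (auto simp: I_def)
        moreover have "{t i..t j} \<subseteq> J q" using J(1)[of q] ij q by (auto simp: nat_interval_def Q_def I_def)
        ultimately show "l \<in> I q" using lp by (auto simp: I_def)
      qed
      show "0 \<le> \<alpha> (t i)" if "i \<in> I q" for i using that \<alpha>(1)[of "t i"] by (auto simp: I_def)
      show "\<alpha> (t j) \<le> \<alpha> (t i)" if "i \<in> I q" "j \<in> I q" "i \<le> j" for i j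
        using that strict_mono_on_leD[OF t] by (intro \<alpha>(2)) (auto simp: I_def)
    qed (use q finI in \<open>auto simp: Q_def\<close>)
    have InfJ: "Inf (J q) \<in> J q" if "q \<in> {1..n}" for q
      using J(1)[OF that] by (intro Inf_nat_def1) (simp add: nat_interval_def)
    have mono: "strict_mono_on Q h" if h: "\<And>q. q \<in> Q \<Longrightarrow> h q \<in> J q" for h
    proof (rule strict_mono_onI)
      fix q r assume qr: "q \<in> Q" "r \<in> Q" "q < r"
      then have "set_less (J q) (J r)" by (intro J(2)) (auto simp: Q_def)
      then show "h q < h r" using h qr by (simp add: set_less_def)
    qed
    \<comment> \<open>Each first support point \<open>g q\<close> lies in \<open>J q\<close>, hence
      not before its minimum, and the minima indexed by \<open>Q\<close> form a subset of a Schreier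
      set.\<close>
    have "g ` Q \<in> schreier k"
    proof (rule schreier_indexed_spreading)
      show "(\<lambda>q. Inf (J q)) ` Q \<in> schreier k"
        by (rule schreier_hereditary[OF infs]) (auto simp: Q_def)
      show "strict_mono_on Q (\<lambda>q. Inf (J q))" using InfJ by (intro mono) (auto simp: Q_def)
      show "strict_mono_on Q g" using gJ by (intro mono)
      show "Inf (J q) \<le> g q" if "q \<in> Q" for q using gJ[OF that] by (simp add: wellorder_Inf_le1)
    qed
    then have "sum \<alpha> (g ` Q) \<le> c" using gJ by (intro c) auto
    moreover have "inj_on g Q" using mono[of g] gJ strict_mono_on_imp_inj_on by blast
    ultimately have sumg: "(\<Sum>q\<in>Q. \<alpha> (g q)) \<le> c" by (simp add: sum.reindex)
    have "r = (\<Sum>q=1..n. \<bar>\<Sum>i\<in>I q. (-1) ^ i * \<alpha> (t i)\<bar>)" unfolding r inner ..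
    also have "\<dots> = (\<Sum>q\<in>Q. \<bar>\<Sum>i\<in>I q. (-1) ^ i * \<alpha> (t i)\<bar>)"
      by (intro sum.mono_neutral_right) (auto simp: Q_def)
    also have "\<dots> \<le> (\<Sum>q\<in>Q. \<alpha> (g q))" by (intro sum_mono first)
    finally show "r \<le> c" using sumg by linarith
  qed
  then show ?thesis by (simp add: y_def[abs_def])
qed

subsection \<open>Countably subadditive seminorms\<close>

text \<open>Baire's theorem makes some sublevel set of \<open>p\<close> dense in a ball; symmetry and convexity move
  the ball to the origin, and successive approximation removes the closure.\<close>

theorem Zabreiko:
  fixes V :: "'a::banach set" and p :: "'a \<Rightarrow> real"
  assumes V: "subspace V" "closed V"
    and nonneg: "\<And>v. v \<in> V \<Longrightarrow> 0 \<le> p v"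
    and scale: "\<And>c v. v \<in> V \<Longrightarrow> p (c *\<^sub>R v) = \<bar>c\<bar> * p v"
    and countably_subadditive:
      "\<And>f v. (\<And>k. f k \<in> V) \<Longrightarrow> summable (\<lambda>k. p (f k)) \<Longrightarrow> f sums v \<Longrightarrow> p v \<le> (\<Sum>k. p (f k))"
  shows "\<exists>C\<ge>0. \<forall>v\<in>V. p v \<le> C * norm v"
proof -
  have p0: "p 0 = 0" using scale[of 0 0] subspace_0[OF V(1)] by simp
  have add: "p (v + w) \<le> p v + p w" if "v \<in> V" "w \<in> V" for v w
  proof -
    \<comment> \<open>Ordinary subadditivity is countable subadditivity for the sequence
      \<open>v, w, 0, 0, ...\<close>.\<close>
    define f where "f k = (if k = 0 then v else if k = Suc 0 then w else 0)" for k :: nat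
    have f: "f k \<in> V" for k using that subspace_0[OF V(1)] by (simp add: f_def)
    have "f sums (\<Sum>k<2. f k)" by (rule sums_finite) (auto simp: f_def)
    moreover have "(\<lambda>k. p (f k)) sums (\<Sum>k<2. p (f k))"
      by (rule sums_finite) (auto simp: f_def p0)
    ultimately show ?thesis
      using countably_subadditive[where f = f and v = "v + w", OF f]
      by (simp add: f_def numeral_2_eq_2 sums_iff)
  qed
  define A where "A k = {v \<in> V. p v \<le> real k}" for k :: nat
  have "\<exists>k. top_of_set V interior_of (V \<inter> closure (A k)) \<noteq> {}"
  proof (rule ccontr)
    assume "\<not> ?thesis"
    then have empty: "top_of_set V interior_of (V \<inter> closure (A k)) = {}" for k by blast
    have "top_of_set V interior_of \<Union>(range (\<lambda>k. V \<inter> closure (A k))) = {}"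
    proof (rule Baire_category_alt)
      have "completely_metrizable_space (top_of_set V)"
        using V(2) by (simp add: completely_metrizable_space_closedin completely_metrizable_space_euclidean)
      then show "completely_metrizable_space (top_of_set V) \<or>
        locally_compact_space (top_of_set V) \<and> regular_space (top_of_set V)" ..
    next
      fix T assume "T \<in> range (\<lambda>k. V \<inter> closure (A k))"
      then show "closedin (top_of_set V) T \<and> top_of_set V interior_of T = {}"
        using empty by (auto intro: closedin_closed_Int)
    qed simp
    moreover have "\<Union>(range (\<lambda>k. V \<inter> closure (A k))) = V"
    proof
      show "V \<subseteq> \<Union>(range (\<lambda>k. V \<inter> closure (A k)))"
      proof
        fix v assume v: "v \<in> V"
        obtain k where "p v \<le> real k" using real_arch_simple by blast
        then have "v \<in> A k" using v by (simp add: A_def)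
        then have "v \<in> closure (A k)" using closure_subset by blast
        then show "v \<in> \<Union>(range (\<lambda>k. V \<inter> closure (A k)))" using v by blast
      qed
    qed auto
    ultimately have "V = {}" using interior_of_topspace[of "top_of_set V"] by simp
    then show False using subspace_0[OF V(1)] by simp
  qed
  then obtain k v0 U where U: "openin (top_of_set V) U" "v0 \<in> U" "U \<subseteq> closure (A k)"
    by (force simp: interior_of_def)
  then obtain r where r: "0 < r" "ball v0 r \<inter> V \<subseteq> U"
    by (metis openin_contains_ball)
  have v0: "v0 \<in> V" using U openin_imp_subset by blast
  \<comment> \<open>Since \<open>v = (1/2) *\<^sub>R ((v0 + v) - (v0 - v))\<close>, half the
    difference of approximants of \<open>v0 + v\<close> and \<open>v0 - v\<close> approximates
    \<open>v\<close>. It stays in \<open>A k\<close> because that set is convex and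
    symmetric.\<close>
  have near0: "\<exists>a\<in>A k. norm (v - a) < e" if v: "v \<in> V" "norm v < r" and e: "0 < e" for v e
  proof -
    have "v0 + v \<in> closure (A k)" "v0 - v \<in> closure (A k)"
      using v v0 V(1) r(2) U(3) by (force simp: dist_norm subspace_add subspace_diff)+
    then obtain a b where ab: "a \<in> A k" "b \<in> A k" "dist a (v0 + v) < e" "dist b (v0 - v) < e"
      using e by (meson closure_approachable)
    let ?c = "(1/2) *\<^sub>R (a + (-1) *\<^sub>R b)"
    have V': "a \<in> V" "b \<in> V" "(-1) *\<^sub>R b \<in> V" "a + (-1) *\<^sub>R b \<in> V"
      using ab V(1) by (auto simp: A_def subspace_diff subspace_neg)
    have "p ?c \<le> (1/2) * (p a + p b)"
      using scale[OF V'(4), of "1/2"] add[OF V'(1,3)] scale[OF V'(2), of "-1"] by simp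
    also have "\<dots> \<le> real k" using ab by (simp add: A_def)
    finally have "?c \<in> A k" using V'(4) V(1) by (simp add: A_def subspace_scale)
    moreover have "norm (v - ?c) < e"
    proof -
      have "v - ?c = (1/2) *\<^sub>R ((v0 + v - a) - (v0 - v - b))"
        by (simp add: algebra_simps flip: scaleR_2)
      also have "norm \<dots> \<le> (1/2) * (norm (v0 + v - a) + norm (v0 - v - b))"
        using norm_triangle_ineq4[of "v0 + v - a" "v0 - v - b"] by simp
      also have "\<dots> < e" using ab by (simp add: dist_norm norm_minus_commute)
      finally show ?thesis .
    qed
    ultimately show ?thesis by blast
  qed
  \<comment> \<open>A nonzero \<open>v\<close> is rescaled to norm \<open>r / 2\<close>, inside the
    ball; undoing this multiplies the bound \<open>k\<close> by
    \<open>2 * norm v / r\<close>.\<close>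
  define D where "D = 2 * real k / r"
  have D: "0 \<le> D" using r by (simp add: D_def)
  have near: "\<exists>a\<in>V. p a \<le> D * norm v \<and> norm (v - a) \<le> e" if v: "v \<in> V" and e: "0 < e" for v e
  proof (cases "v = 0")
    case True
    then show ?thesis using v e p0 by (intro bexI[of _ 0]) auto
  next
    case False
    define s where "s = r / (2 * norm v)"
    have s: "0 < s" "norm (s *\<^sub>R v) < r" using False r by (auto simp: s_def)
    then obtain a where a: "a \<in> A k" "norm (s *\<^sub>R v - a) < s * e"
      using near0[of "s *\<^sub>R v" "s * e"] v e V(1) by (auto simp: subspace_scale)
    have "p ((1/s) *\<^sub>R a) \<le> D * norm v"
    proof -
      have "p ((1/s) *\<^sub>R a) = (1/s) * p a" using a s scale[of a "1/s"] by (simp add: A_def)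
      also have "\<dots> \<le> (1/s) * real k" using a s by (intro mult_left_mono) (auto simp: A_def)
      also have "\<dots> = D * norm v" by (simp add: s_def D_def)
      finally show ?thesis .
    qed
    moreover have "norm (v - (1/s) *\<^sub>R a) \<le> e"
    proof -
      have "v - (1/s) *\<^sub>R a = (1/s) *\<^sub>R (s *\<^sub>R v - a)" using s by (simp add: scaleR_diff_right)
      also have "norm \<dots> = norm (s *\<^sub>R v - a) / s" using s by simp
      also have "\<dots> \<le> e" using a s by (simp add: divide_le_eq mult.commute less_imp_le)
      finally show ?thesis .
    qed
    ultimately show ?thesis using a V(1) by (intro bexI[of _ "(1/s) *\<^sub>R a"]) (auto simp: A_def subspace_scale)
  qed
  have "p v \<le> 2 * D * norm v" if v: "v \<in> V" for v
  proof (cases "v = 0")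
    case True
    then show ?thesis using p0 by simp
  next
    case False
    define N where "N = norm v"
    have N: "0 < N" using False by (simp add: N_def)
    obtain g where g: "\<And>w e. w \<in> V \<Longrightarrow> 0 < e \<Longrightarrow> g w e \<in> V \<and> p (g w e) \<le> D * norm w \<and> norm (w - g w e) \<le> e"
      using near by metis
    \<comment> \<open>\<open>R i\<close> is the error left after \<open>i\<close> corrections. The
      tolerances halve, so the \<open>i\<close>-th correction has \<open>p\<close>-value at most
      \<open>D * N / 2 ^ i\<close>, and these add up to \<open>2 * D * N\<close>.\<close>
    define R where "R = rec_nat v (\<lambda>i w. w - g w (N / 2 ^ Suc i))"
    have R0: "R 0 = v" and RS: "R (Suc i) = R i - g (R i) (N / 2 ^ Suc i)" for i
      by (simp_all add: R_def)
    have R: "R i \<in> V \<and> norm (R i) \<le> N / 2 ^ i" for i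
    proof (induction i)
      case (Suc i)
      have "0 < N / 2 ^ Suc i" using N by simp
      then show ?case using g[of "R i" "N / 2 ^ Suc i"] Suc RS[of i] V(1) by (auto simp: subspace_diff)
    qed (simp add: R0 v N_def)
    define f where "f i = R i - R (Suc i)" for i
    have fg: "f i = g (R i) (N / 2 ^ Suc i)" for i by (simp add: f_def RS)
    have f: "f i \<in> V" "p (f i) \<le> D * N * (1/2) ^ i" for i
    proof -
      have e: "0 < N / 2 ^ Suc i" using N by simp
      show "f i \<in> V" using g[OF _ e] R fg by metis
      have "p (f i) \<le> D * norm (R i)" using g[OF _ e] R fg by metis
      also have "\<dots> \<le> D * (N / 2 ^ i)" using R D by (intro mult_left_mono) auto
      finally show "p (f i) \<le> D * N * (1/2) ^ i" by (simp add: power_one_over)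
    qed
    have "(\<lambda>i. N / 2 ^ i) \<longlonglongrightarrow> 0"
      using tendsto_mult_right_zero[OF LIMSEQ_realpow_zero[of "1/2"], of N] by (simp add: power_one_over)
    then have "R \<longlonglongrightarrow> 0" using R by (intro Lim_null_comparison[of R "\<lambda>i. N / 2 ^ i"]) auto
    then have "f sums (R 0 - 0)" unfolding f_def by (rule telescope_sums')
    then have fv: "f sums v" by (simp add: R0)
    have geo: "(\<lambda>i. D * N * (1/2) ^ i) sums (D * N * 2)"
      using sums_mult[OF geometric_sums[of "1/2::real"], of "D * N"] by simp
    have sp: "summable (\<lambda>i. p (f i))"
      using f nonneg by (intro summable_comparison_test'[OF sums_summable[OF geo], of 0]) auto
    have "p v \<le> (\<Sum>i. p (f i))" using countably_subadditive[OF f(1) sp fv] .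
    also have "\<dots> \<le> D * N * 2" using f(2) sp geo by (metis suminf_le sums_iff)
    finally show ?thesis by (simp add: N_def)
  qed
  then show ?thesis using D by (intro exI[of _ "2 * D"]) auto
qed

text \<open>\<open>P\<close> is the projection of the sum onto \<open>Y\<close> along
  \<open>Z\<close>. Its norm is countably subadditive: if the norms of the \<open>P (f k)\<close>
  are summable, then the series of the \<open>P (f k)\<close> converges in \<open>Y\<close> and the
  complementary series in \<open>Z\<close>, both being closed, and uniqueness of the decomposition
  identifies the limit with \<open>P v\<close>.\<close>

lemma bounded_decomposition:
  fixes Y Z :: "'a::banach set"
  assumes Y: "subspace Y" "closed Y" and Z: "subspace Z" "closed Z"
    and int: "Y \<inter> Z = {0}" and sum: "closed {y + z | y z. y \<in> Y \<and> z \<in> Z}"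
  shows "\<exists>C\<ge>0. \<forall>y\<in>Y. \<forall>z\<in>Z. norm y \<le> C * norm (y + z)"
proof -
  let ?V = "{y + z | y z. y \<in> Y \<and> z \<in> Z}"
  define P where "P v = (THE y. y \<in> Y \<and> v - y \<in> Z)" for v
  have P: "P v = y" if "y \<in> Y" "v - y \<in> Z" for y v
    unfolding P_def
  proof (rule the_equality)
    fix y' assume y': "y' \<in> Y \<and> v - y' \<in> Z"
    have "(v - y) - (v - y') \<in> Z" using y' that Z(1) subspace_diff by blast
    then have "y' - y \<in> Z" by (simp add: algebra_simps)
    moreover have "y' - y \<in> Y" using y' that Y(1) subspace_diff by blast
    ultimately have "y' - y \<in> {0}" using int by blast
    then show "y' = y" by simp
  qed (use that in simp)
  have PV: "P v \<in> Y \<and> v - P v \<in> Z" if "v \<in> ?V" for v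
  proof -
    obtain y z where "y \<in> Y" "z \<in> Z" "v = y + z" using \<open>v \<in> ?V\<close> by blast
    then have yz: "y \<in> Y" "v - y \<in> Z" by simp_all
    then have "P v = y" by (rule P)
    then show ?thesis using yz by simp
  qed
  have "\<exists>C\<ge>0. \<forall>v\<in>?V. norm (P v) \<le> C * norm v"
  proof (rule Zabreiko)
    show "subspace ?V" using Y(1) Z(1) by (rule subspace_sums)
    show "closed ?V" by (rule sum)
    show "norm (P (c *\<^sub>R v)) = \<bar>c\<bar> * norm (P v)" if "v \<in> ?V" for c v
    proof -
      have "c *\<^sub>R P v \<in> Y" "c *\<^sub>R v - c *\<^sub>R P v \<in> Z"
        using PV[OF that] Y(1) Z(1) by (auto simp: subspace_scale simp flip: scaleR_diff_right)
      then have "P (c *\<^sub>R v) = c *\<^sub>R P v" by (rule P)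
      then show ?thesis by simp
    qed
    show "norm (P v) \<le> (\<Sum>k. norm (P (f k)))"
      if f: "\<And>k. f k \<in> ?V" "summable (\<lambda>k. norm (P (f k)))" "f sums v" for f v
    proof -
      have s: "summable (\<lambda>k. P (f k))" using f(2) by (rule summable_norm_cancel)
      have "(\<Sum>k. P (f k)) \<in> Y"
        using s[THEN summable_LIMSEQ] PV[OF f(1)] Y
        by (intro closed_sequentially[OF Y(2) _ s[THEN summable_LIMSEQ]] subspace_sum) auto
      moreover have "(\<lambda>k. f k - P (f k)) sums (v - (\<Sum>k. P (f k)))"
        using f(3) s by (intro sums_diff) auto
      then have "v - (\<Sum>k. P (f k)) \<in> Z"
        unfolding sums_def
      proof (rule closed_sequentially[OF Z(2), rotated])
        show "(\<Sum>k<i. f k - P (f k)) \<in> Z" for i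
          using PV[OF f(1)] by (intro subspace_sum[OF Z(1)]) blast
      qed
      ultimately have "P v = (\<Sum>k. P (f k))" by (rule P)
      then show ?thesis using summable_norm[OF f(2)] by simp
    qed
  qed simp
  then obtain C where C: "C \<ge> 0" "\<forall>v\<in>?V. norm (P v) \<le> C * norm v" by blast
  have "norm y \<le> C * norm (y + z)" if "y \<in> Y" "z \<in> Z" for y z
  proof -
    have "P (y + z) = y" using that by (intro P) auto
    then show ?thesis using C(2) that by force
  qed
  then show ?thesis using C(1) by blast
qed

subsection \<open>Schauder bases\<close>

lemma subspace_closed_span: "subspace (closed_span (B :: 'a::real_normed_vector set))"
  unfolding closed_span_def
proof (rule subspaceI)
  show "0 \<in> closure (span B)" using span_zero closure_subset by blast
  fix v w assume "v \<in> closure (span B)" "w \<in> closure (span B)"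
  then obtain f g where fg: "\<And>n. f n \<in> span B" "f \<longlonglongrightarrow> v" "\<And>n. g n \<in> span B" "g \<longlonglongrightarrow> w"
    unfolding closure_sequential by blast
  then have "(\<lambda>n. f n + g n) \<longlonglongrightarrow> v + w" "\<And>n. f n + g n \<in> span B"
    by (auto intro: tendsto_add span_add)
  then show "v + w \<in> closure (span B)"
    unfolding closure_sequential by (intro exI[of _ "\<lambda>n. f n + g n"]) simp
next
  fix c v assume "v \<in> closure (span B)"
  then obtain f where f: "\<And>n. f n \<in> span B" "f \<longlonglongrightarrow> v"
    unfolding closure_sequential by blast
  then have "(\<lambda>n. c *\<^sub>R f n) \<longlonglongrightarrow> c *\<^sub>R v" "\<And>n. c *\<^sub>R f n \<in> span B"
    by (auto intro: tendsto_scaleR span_scale)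
  then show "c *\<^sub>R v \<in> closure (span B)"
    unfolding closure_sequential by (intro exI[of _ "\<lambda>n. c *\<^sub>R f n"]) simp
qed

lemma closed_closed_span: "closed (closed_span B)"
  by (simp add: closed_span_def)

lemma span_subset_closed_span: "span B \<subseteq> closed_span B"
  by (simp add: closed_span_def closure_subset)

lemma basis_expansion_ex1:
  assumes "schauder_basis_of u V" "v \<in> V"
  shows "\<exists>!a. basis_expansion u v a"
  using assms(1)[unfolded schauder_basis_of_def, THEN conjunct2, rule_format, OF assms(2)] .

lemma basis_expansion_coords:
  "schauder_basis_of u V \<Longrightarrow> v \<in> V \<Longrightarrow> basis_expansion u v (coords u v)"
  unfolding coords_def by (rule theI'[OF basis_expansion_ex1])

lemma coords_eqI:
  "schauder_basis_of u V \<Longrightarrow> v \<in> V \<Longrightarrow> basis_expansion u v a \<Longrightarrow> coords u v = a"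
  unfolding coords_def by (rule the1_equality[OF basis_expansion_ex1])

lemma coords_0_index: "schauder_basis_of u V \<Longrightarrow> v \<in> V \<Longrightarrow> coords u v 0 = 0"
  using basis_expansion_coords basis_expansion_def by blast

lemma coords_add:
  assumes "schauder_basis_of u V" "subspace V" "v \<in> V" "w \<in> V"
  shows "coords u (v + w) i = coords u v i + coords u w i"
proof -
  have "basis_expansion u (v + w) (\<lambda>i. coords u v i + coords u w i)"
    using basis_expansion_coords[OF assms(1,3)] basis_expansion_coords[OF assms(1,4)]
    by (auto simp: basis_expansion_def scaleR_add_left sum.distrib intro: tendsto_add)
  then show ?thesis using coords_eqI[OF assms(1) subspace_add[OF assms(2-4)]] by simp
qed

lemma coords_scaleR:
  assumes "schauder_basis_of u V" "subspace V" "v \<in> V"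
  shows "coords u (c *\<^sub>R v) i = c * coords u v i"
proof -
  have "basis_expansion u (c *\<^sub>R v) (\<lambda>i. c * coords u v i)"
    using basis_expansion_coords[OF assms(1,3)] tendsto_scaleR[OF tendsto_const[of c]]
    by (fastforce simp: basis_expansion_def scaleR_sum_right simp flip: scaleR_scaleR)
  then show ?thesis using coords_eqI[OF assms(1) subspace_scale[OF assms(2,3)]] by simp
qed

lemma basis_expansion_finite:
  assumes "finite F" "F \<subseteq> {1..}"
  shows "basis_expansion u (\<Sum>i\<in>F. c i *\<^sub>R u i) (\<lambda>i. if i \<in> F then c i else 0)"
proof -
  obtain M where M: "F \<subseteq> {..M}" using assms(1) finite_nat_iff_bounded_le by blast
  have "(\<Sum>i=1..N. (if i \<in> F then c i else 0) *\<^sub>R u i) = (\<Sum>i\<in>F. c i *\<^sub>R u i)" if "M \<le> N" for N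
  proof -
    have "(\<Sum>i\<in>F. c i *\<^sub>R u i) = (\<Sum>i\<in>F. (if i \<in> F then c i else 0) *\<^sub>R u i)" by simp
    also have "\<dots> = (\<Sum>i=1..N. (if i \<in> F then c i else 0) *\<^sub>R u i)"
      using assms(2) M that by (intro sum.mono_neutral_left) force+
    finally show ?thesis by simp
  qed
  then have "(\<lambda>N. \<Sum>i=1..N. (if i \<in> F then c i else 0) *\<^sub>R u i) \<longlonglongrightarrow> (\<Sum>i\<in>F. c i *\<^sub>R u i)"
    by (intro tendsto_eventually eventually_sequentiallyI[of M])
  then show ?thesis using assms(2) by (force simp: basis_expansion_def)
qed

lemma coords_finite_sum:
  assumes "schauder_basis_of u V" "subspace V" "finite F" "F \<subseteq> {1..}"
  shows "coords u (\<Sum>i\<in>F. c i *\<^sub>R u i) = (\<lambda>i. if i \<in> F then c i else 0)"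
proof (rule coords_eqI[OF assms(1) _ basis_expansion_finite[OF assms(3,4)]])
  have "u i \<in> V" if "i \<in> F" for i
    using assms(1,4) that by (auto simp: schauder_basis_of_def)
  then show "(\<Sum>i\<in>F. c i *\<^sub>R u i) \<in> V"
    by (intro subspace_sum[OF assms(2)] subspace_scale[OF assms(2)])
qed

text \<open>A zero basis vector would let \<open>0\<close> have two different expansions.\<close>

lemma basis_vector_nonzero:
  assumes "schauder_basis_of u V" "subspace V" "1 \<le> i"
  shows "u i \<noteq> 0"
proof
  assume "u i = 0"
  then have "(\<Sum>k\<in>{i}. 1 *\<^sub>R u k) = (\<Sum>k\<in>{}. 1 *\<^sub>R u k)" by simp
  then have "coords u (\<Sum>k\<in>{i}. 1 *\<^sub>R u k) i = coords u (\<Sum>k\<in>{}. 1 *\<^sub>R u k) i" by metis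
  then show False
    using coords_finite_sum[OF assms(1,2), of "{i}" "\<lambda>_. 1"] coords_finite_sum[OF assms(1,2), of "{}" "\<lambda>_. 1"] assms(3)
    by simp
qed

section \<open>Coordinate projections and their uniform bounds\<close>

definition coord_proj :: "(nat \<Rightarrow> 'a::real_normed_vector) \<Rightarrow> nat set \<Rightarrow> 'a \<Rightarrow> 'a" where
  "coord_proj u F v = (\<Sum>i\<in>F. coords u v i *\<^sub>R u i)"

lemma coord_proj_tendsto:
  assumes "schauder_basis_of u V" "v \<in> V"
  shows "(\<lambda>N. coord_proj u {1..N} v) \<longlonglongrightarrow> v"
  using basis_expansion_coords[OF assms] by (simp add: basis_expansion_def coord_proj_def)

lemma coord_proj_scaleR:
  assumes "schauder_basis_of u V" "subspace V" "v \<in> V"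
  shows "coord_proj u F (c *\<^sub>R v) = c *\<^sub>R coord_proj u F v"
  using coords_scaleR[OF assms] by (simp add: coord_proj_def scaleR_sum_right)

lemma coord_proj_add:
  assumes "schauder_basis_of u V" "subspace V" "v \<in> V" "w \<in> V"
  shows "coord_proj u F (v + w) = coord_proj u F v + coord_proj u F w"
  using coords_add[OF assms] by (simp add: coord_proj_def scaleR_add_left sum.distrib)

lemma coords_le_coord_proj:
  assumes "1 \<le> i"
  shows "\<bar>coords u v i\<bar> * norm (u i) \<le> norm (coord_proj u {1..i} v) + norm (coord_proj u {1..i - 1} v)"
proof -
  have "{1..i} = insert i {1..i - 1}" "i \<notin> {1..i - 1}" using assms by auto
  then have "coords u v i *\<^sub>R u i = coord_proj u {1..i} v - coord_proj u {1..i - 1} v"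
    by (simp add: coord_proj_def)
  then show ?thesis by (metis norm_scaleR norm_triangle_ineq4)
qed

text \<open>Boundedness of the single projections is not yet known, so the principle for countably
  subadditive seminorms is applied to the supremum \<open>p\<close>. Suppose \<open>f sums v\<close>
  with summable \<open>p (f k)\<close>. The coordinates of the \<open>f k\<close> can be summed
  termwise, and dominated convergence shows that the resulting coefficients expand \<open>v\<close>;
  uniqueness makes them its coordinates, so the projections of \<open>v\<close> are sums of those of
  the \<open>f k\<close>. The family \<open>\<F>\<close> will be the initial segments for the basis
  constant and all finite sets for the unconditional constant.\<close>

theorem coord_proj_uniformly_bounded:
  fixes u :: "nat \<Rightarrow> 'a::banach"
  assumes V: "subspace V" "closed V" and u: "schauder_basis_of u V"
    and \<F>: "\<And>F. F \<in> \<F> \<Longrightarrow> finite F" "\<And>N. {1..N} \<in> \<F>"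
    and bdd: "\<And>v. v \<in> V \<Longrightarrow> bdd_above ((\<lambda>F. norm (coord_proj u F v)) ` \<F>)"
  shows "\<exists>C>0. \<forall>v\<in>V. \<forall>F\<in>\<F>. norm (coord_proj u F v) \<le> C * norm v"
proof -
  define p where "p v = (SUP F\<in>\<F>. norm (coord_proj u F v))" for v
  have upper: "norm (coord_proj u F v) \<le> p v" if "v \<in> V" "F \<in> \<F>" for v F
    unfolding p_def using bdd that by (intro cSUP_upper) auto
  have least: "p v \<le> c" if "\<And>F. F \<in> \<F> \<Longrightarrow> norm (coord_proj u F v) \<le> c" for v c
    unfolding p_def using that \<F>(2) by (intro cSUP_least) auto
  \<comment> \<open>The initial segments belong to \<open>\<F>\<close>, and \<open>v\<close> is the
    limit of their projections. They likewise let \<open>p\<close> control each coordinate, through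
    consecutive differences.\<close>
  have norm_le: "norm v \<le> p v" if "v \<in> V" for v
    using upper[OF that \<F>(2)]
    by (intro Lim_norm_ubound[OF _ coord_proj_tendsto[OF u that]]) (auto intro: always_eventually)
  have nonneg: "0 \<le> p v" if "v \<in> V" for v
    using norm_le[OF that] norm_ge_zero order_trans by blast
  have scale_le: "p (c *\<^sub>R v) \<le> \<bar>c\<bar> * p v" if "v \<in> V" for c v
    using upper[OF that] by (intro least) (simp add: coord_proj_scaleR[OF u V(1) that] mult_left_mono)
  have "\<exists>C\<ge>0. \<forall>v\<in>V. p v \<le> C * norm v"
  proof (rule Zabreiko[OF V])
    show "0 \<le> p v" if "v \<in> V" for v using that by (rule nonneg)
    show "p (c *\<^sub>R v) = \<bar>c\<bar> * p v" if v: "v \<in> V" for c v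
    proof (cases "c = 0")
      case True
      then show ?thesis using scale_le[OF v, of 0] nonneg[OF subspace_0[OF V(1)]] by simp
    next
      case False
      have "p ((1/c) *\<^sub>R (c *\<^sub>R v)) \<le> \<bar>1/c\<bar> * p (c *\<^sub>R v)"
        using v V(1) by (intro scale_le) (simp add: subspace_scale)
      then have "\<bar>c\<bar> * p v \<le> p (c *\<^sub>R v)" using False by (simp add: field_simps)
      then show ?thesis using scale_le[OF v] by (simp add: antisym)
    qed
    show "p v \<le> (\<Sum>k. p (f k))"
      if f: "\<And>k. f k \<in> V" "summable (\<lambda>k. p (f k))" "f sums v" for f v
    proof -
      have v: "v \<in> V"
        using f(3) unfolding sums_def
        by (rule closed_sequentially[OF V(2), rotated]) (intro subspace_sum[OF V(1)] f(1))
      have "summable (\<lambda>k. coords u (f k) i)" if "1 \<le> i" for i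
      proof (rule summable_comparison_test'[where N = 0])
        have ui: "norm (u i) > 0" using basis_vector_nonzero[OF u V(1) that] by simp
        show "norm (coords u (f k) i) \<le> (2 / norm (u i)) * p (f k)" for k
        proof -
          have "\<bar>coords u (f k) i\<bar> * norm (u i) \<le> 2 * p (f k)"
            using coords_le_coord_proj[OF that, of u "f k"] upper[OF f(1)[of k] \<F>(2)[of i]]
              upper[OF f(1)[of k] \<F>(2)[of "i - 1"]] by linarith
          then show ?thesis using ui by (simp add: field_simps)
        qed
        show "summable (\<lambda>k. (2 / norm (u i)) * p (f k))" using f(2) by (rule summable_mult)
      qed
      moreover have "summable (\<lambda>k. coords u (f k) 0)" using coords_0_index[OF u f(1)] by simp
      ultimately have summ: "summable (\<lambda>k. coords u (f k) i)" for i
        by (cases i) auto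
      define a where "a i = (\<Sum>k. coords u (f k) i)" for i
      have a: "(\<lambda>k. coords u (f k) i) sums a i" for i
        unfolding a_def using summ by (rule summable_sums)
      have P: "(\<lambda>k. coord_proj u F (f k)) sums (\<Sum>i\<in>F. a i *\<^sub>R u i)" for F
        unfolding coord_proj_def
        by (intro sums_sum bounded_linear.sums[OF bounded_linear_scaleR_left] a)
      \<comment> \<open>Tannery's theorem exchanges the limit in \<open>N\<close> with the sum over
        \<open>k\<close>; the dominating series is \<open>2 * p (f k)\<close>.\<close>
      have tail: "(\<lambda>N. \<Sum>k. norm (f k - coord_proj u {1..N} (f k))) \<longlonglongrightarrow> (\<Sum>k. 0)"
        and tail_summable: "summable (\<lambda>k. norm (f k - coord_proj u {1..N} (f k)))" for N
      proof -
        have le: "norm (f k - coord_proj u {1..N} (f k)) \<le> 2 * p (f k)" for k N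
          using norm_triangle_ineq4[of "f k" "coord_proj u {1..N} (f k)"] norm_le[OF f(1)[of k]]
            upper[OF f(1)[of k] \<F>(2)[of N]] by linarith
        have s: "summable (\<lambda>k. 2 * p (f k))" using f(2) by (rule summable_mult)
        show "summable (\<lambda>k. norm (f k - coord_proj u {1..N} (f k)))"
          using le by (intro summable_comparison_test'[OF s, of 0]) simp
        have lim: "(\<lambda>N. norm (f k - coord_proj u {1..N} (f k))) \<longlonglongrightarrow> 0" for k
          using tendsto_diff[OF tendsto_const coord_proj_tendsto[OF u f(1)], of "f k" k]
          by (simp add: tendsto_norm_zero)
        show "(\<lambda>N. \<Sum>k. norm (f k - coord_proj u {1..N} (f k))) \<longlonglongrightarrow> (\<Sum>k. 0)"
          using tannerys_theorem[where F = sequentially and M = "\<lambda>k. 2 * p (f k)" and b = "\<lambda>_. 0 :: real"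
            and a = "\<lambda>k N. norm (f k - coord_proj u {1..N} (f k))", OF lim always_eventually s] le by simp
      qed
      have "(\<lambda>N. (\<Sum>i=1..N. a i *\<^sub>R u i)) \<longlonglongrightarrow> v"
      proof (rule Lim_transform[OF tendsto_const])
        show "(\<lambda>N. (\<Sum>i=1..N. a i *\<^sub>R u i) - v) \<longlonglongrightarrow> 0"
        proof (rule Lim_null_comparison)
          show "(\<lambda>N. \<Sum>k. norm (f k - coord_proj u {1..N} (f k))) \<longlonglongrightarrow> 0" using tail by simp
          have "norm ((\<Sum>i=1..N. a i *\<^sub>R u i) - v) \<le> (\<Sum>k. norm (f k - coord_proj u {1..N} (f k)))" for N
          proof -
            have "v - (\<Sum>i=1..N. a i *\<^sub>R u i) = (\<Sum>k. f k - coord_proj u {1..N} (f k))"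
              using sums_diff[OF f(3) P[of "{1..N}"]] by (simp add: sums_iff)
            then show ?thesis using summable_norm[OF tail_summable[of N]] by (simp add: norm_minus_commute)
          qed
          then show "\<forall>\<^sub>F N in sequentially. norm ((\<Sum>i=1..N. a i *\<^sub>R u i) - v)
              \<le> (\<Sum>k. norm (f k - coord_proj u {1..N} (f k)))"
            by (intro always_eventually) blast
        qed
      qed
      moreover have "a 0 = 0" using coords_0_index[OF u f(1)] by (simp add: a_def)
      ultimately have "coords u v = a"
        using coords_eqI[OF u v] by (simp add: basis_expansion_def)
      then have Pv: "(\<lambda>k. coord_proj u F (f k)) sums coord_proj u F v" for F
        using P by (simp add: coord_proj_def)
      show ?thesis
      proof (rule least)
        fix F assume "F \<in> \<F>"
        then have "norm (\<Sum>k. coord_proj u F (f k)) \<le> (\<Sum>k. p (f k))"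
          using upper[OF f(1)] f(2) by (intro norm_suminf_le)
        then show "norm (coord_proj u F v) \<le> (\<Sum>k. p (f k))" using Pv[of F] by (simp add: sums_iff)
      qed
    qed
  qed
  then obtain C where C: "C \<ge> 0" "\<And>v. v \<in> V \<Longrightarrow> p v \<le> C * norm v" by blast
  have "norm (coord_proj u F v) \<le> (C + 1) * norm v" if "v \<in> V" "F \<in> \<F>" for v F
  proof -
    have "C * norm v \<le> (C + 1) * norm v" by (intro mult_right_mono) auto
    then show ?thesis using upper[OF that] C(2)[OF that(1)] by linarith
  qed
  then show ?thesis using C(1) by (intro exI[of _ "C + 1"]) auto
qed

lemma basis_constant:
  fixes u :: "nat \<Rightarrow> 'a::banach"
  assumes "subspace V" "closed V" "schauder_basis_of u V"
  shows "\<exists>C>0. \<forall>v\<in>V. \<forall>N. norm (coord_proj u {1..N} v) \<le> C * norm v"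
proof -
  have "\<exists>C>0. \<forall>v\<in>V. \<forall>F\<in>range (\<lambda>N. {1..N}). norm (coord_proj u F v) \<le> C * norm v"
  proof (rule coord_proj_uniformly_bounded[OF assms])
    fix v assume "v \<in> V"
    then have "convergent (\<lambda>N. coord_proj u {1..N} v)"
      using coord_proj_tendsto[OF assms(3)] convergentI by blast
    then have "Bseq (\<lambda>N. coord_proj u {1..N} v)" by (rule convergent_imp_Bseq)
    then obtain K where "\<And>N. norm (coord_proj u {1..N} v) \<le> K" by (rule BseqE) blast
    then show "bdd_above ((\<lambda>F. norm (coord_proj u F v)) ` range (\<lambda>N. {1..N}))" by (intro bdd_aboveI2[of _ _ K]) auto
  qed auto
  then show ?thesis by simp
qed

text \<open>Beyond some finite \<open>F0\<close> all sums stay within distance \<open>1\<close> of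
  the limit. An arbitrary \<open>F\<close> is enlarged by \<open>F0\<close>, and the added terms
  cost at most the sum of the norms over \<open>F0\<close>.\<close>

lemma summable_on_finite_sums_bounded:
  fixes f :: "'i \<Rightarrow> 'a::real_normed_vector"
  assumes "f summable_on A"
  shows "\<exists>K. \<forall>F. finite F \<and> F \<subseteq> A \<longrightarrow> norm (sum f F) \<le> K"
proof -
  obtain s where "(f has_sum s) A" using assms by (auto simp: summable_on_def)
  then have "(sum f \<longlongrightarrow> s) (finite_subsets_at_top A)" by (simp add: has_sum_def)
  then have "\<forall>\<^sub>F F in finite_subsets_at_top A. dist (sum f F) s < 1" by (rule tendstoD) simp
  then obtain F0 where F0: "finite F0" "F0 \<subseteq> A"
    "\<forall>F. finite F \<and> F0 \<subseteq> F \<and> F \<subseteq> A \<longrightarrow> dist (sum f F) s < 1"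
    unfolding eventually_finite_subsets_at_top by (elim exE conjE)
  have "norm (sum f F) \<le> norm s + 1 + (\<Sum>i\<in>F0. norm (f i))" if F: "finite F" "F \<subseteq> A" for F
  proof -
    have "sum f (F \<union> (F0 - F)) = sum f F + sum f (F0 - F)"
      using F F0 by (intro sum.union_disjoint) auto
    then have "sum f (F \<union> F0) = sum f F + sum f (F0 - F)" by simp
    then have "norm (sum f F) \<le> norm (sum f (F \<union> F0)) + norm (sum f (F0 - F))"
      by (metis add_diff_cancel_right' norm_triangle_ineq4)
    moreover have "dist (sum f (F \<union> F0)) s < 1" using F F0 by auto
    then have "norm (sum f (F \<union> F0)) \<le> norm s + 1"
      using norm_triangle_ineq2[of "sum f (F \<union> F0)" s] by (simp add: dist_norm)
    moreover have "norm (sum f (F0 - F)) \<le> (\<Sum>i\<in>F0 - F. norm (f i))" by (rule norm_sum)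
    moreover have "\<dots> \<le> (\<Sum>i\<in>F0. norm (f i))" using F0 by (intro sum_mono2) auto
    ultimately show ?thesis by linarith
  qed
  then show ?thesis by blast
qed

lemma unconditional_constant:
  fixes u :: "nat \<Rightarrow> 'a::banach"
  assumes "unconditional_basic_sequence u"
  shows "\<exists>C>0. \<forall>v\<in>closed_span (u ` {1..}). \<forall>F. finite F \<and> F \<subseteq> {1..} \<longrightarrow>
    norm (coord_proj u F v) \<le> C * norm v"
proof -
  let ?V = "closed_span (u ` {1..})"
  have u: "schauder_basis_of u ?V"
    and unc: "\<And>a :: nat \<Rightarrow> real. convergent (\<lambda>N. \<Sum>i=1..N. a i *\<^sub>R u i) \<Longrightarrow> (\<lambda>i. a i *\<^sub>R u i) summable_on {1..}"
    using assms by (auto simp: unconditional_basic_sequence_def basic_sequence_def)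
  have "\<exists>C>0. \<forall>v\<in>?V. \<forall>F\<in>{F. finite F \<and> F \<subseteq> {1..}}. norm (coord_proj u F v) \<le> C * norm v"
  proof (rule coord_proj_uniformly_bounded[OF subspace_closed_span closed_closed_span u])
    fix v assume "v \<in> ?V"
    then have "convergent (\<lambda>N. \<Sum>i=1..N. coords u v i *\<^sub>R u i)"
      using coord_proj_tendsto[OF u] unfolding coord_proj_def by (blast intro: convergentI)
    from summable_on_finite_sums_bounded[OF unc[OF this]]
    obtain K where "\<And>F. finite F \<Longrightarrow> F \<subseteq> {1..} \<Longrightarrow> norm (coord_proj u F v) \<le> K"
      unfolding coord_proj_def by blast
    then show "bdd_above ((\<lambda>F. norm (coord_proj u F v)) ` {F. finite F \<and> F \<subseteq> {1..}})"
      by (intro bdd_aboveI2[of _ _ K]) auto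
  qed auto
  then show ?thesis by simp
qed

lemma bounded_linear_coords:
  fixes u :: "nat \<Rightarrow> 'a::banach"
  assumes "schauder_basis_of u UNIV"
  shows "bounded_linear (\<lambda>v. coords u v i)"
proof (cases "i = 0")
  case True
  then show ?thesis using coords_0_index[OF assms] by simp
next
  case False
  then have i: "1 \<le> i" by simp
  obtain C where C: "C > 0" "\<And>v N. norm (coord_proj u {1..N} v) \<le> C * norm v"
    using basis_constant[OF subspace_UNIV closed_UNIV assms] by blast
  have ui: "norm (u i) > 0" using basis_vector_nonzero[OF assms subspace_UNIV i] by simp
  show ?thesis
  proof (rule bounded_linear_intro)
    fix v
    have "\<bar>coords u v i\<bar> * norm (u i) \<le> 2 * (C * norm v)"
      using coords_le_coord_proj[OF i, of u v] C(2)[of i v] C(2)[of "i - 1" v] by linarith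
    then show "norm (coords u v i) \<le> norm v * (2 * C / norm (u i))"
      using ui by (simp add: field_simps)
  qed (auto simp: coords_add[OF assms] coords_scaleR[OF assms])
qed

section \<open>Coordinates on spans, and infinite dimension\<close>

lemma closed_span_minimal: "B \<subseteq> E \<Longrightarrow> subspace E \<Longrightarrow> closed E \<Longrightarrow> closed_span B \<subseteq> E"
  unfolding closed_span_def by (intro closure_minimal span_minimal)

lemma coords_ext:
  assumes "schauder_basis_of u V" "v \<in> V" "w \<in> V" "\<And>i. 1 \<le> i \<Longrightarrow> coords u v i = coords u w i"
  shows "v = w"
proof -
  have "coord_proj u {1..N} v = coord_proj u {1..N} w" for N
    unfolding coord_proj_def using assms(4) by (intro sum.cong) auto
  then show ?thesis
    using coord_proj_tendsto[OF assms(1,2)] coord_proj_tendsto[OF assms(1,3)] LIMSEQ_unique by simp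
qed

lemma coords_basis_vector:
  assumes "schauder_basis_of u V" "subspace V" "1 \<le> k"
  shows "coords u (u k) i = (if i = k then 1 else 0)"
  using coords_finite_sum[OF assms(1,2), of "{k}" "\<lambda>_. 1"] assms(3) by simp

lemma coords_span_zero:
  assumes "schauder_basis_of u V" "subspace V" "A \<subseteq> {1..}" "v \<in> span (u ` A)" "i \<notin> A"
  shows "coords u v i = 0"
proof -
  have V: "u k \<in> V" if "1 \<le> k" for k using assms(1) that by (simp add: schauder_basis_of_def)
  have "subspace {v \<in> V. coords u v i = 0}"
  proof (rule subspaceI)
    have "coords u (0 *\<^sub>R 0) i = 0 * coords u 0 i"
      using coords_scaleR[OF assms(1,2) subspace_0[OF assms(2)]] .
    then show "0 \<in> {v \<in> V. coords u v i = 0}" using subspace_0[OF assms(2)] by simp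
  qed (use assms(2) in \<open>auto simp: subspace_add subspace_scale coords_add[OF assms(1,2)]
      coords_scaleR[OF assms(1,2)]\<close>)
  moreover have "u ` A \<subseteq> {v \<in> V. coords u v i = 0}"
    using assms(3,5) V coords_basis_vector[OF assms(1,2)] by auto
  ultimately have "span (u ` A) \<subseteq> {v \<in> V. coords u v i = 0}" by (intro span_minimal)
  then show ?thesis using assms(4) by auto
qed

lemma coord_proj_span:
  assumes u: "schauder_basis_of u V" "subspace V" and A: "A \<subseteq> {1..}" "v \<in> span (u ` A)"
  shows "finite F \<Longrightarrow> A \<subseteq> F \<Longrightarrow> coord_proj u F v = v" "A \<inter> F = {} \<Longrightarrow> coord_proj u F v = 0"
proof -
  have zero: "coords u v i = 0" if "i \<notin> A" for i using coords_span_zero[OF u A that] .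
  show "A \<inter> F = {} \<Longrightarrow> coord_proj u F v = 0"
    unfolding coord_proj_def using zero by (intro sum.neutral) auto
  assume F: "finite F" "A \<subseteq> F"
  have "u ` A \<subseteq> V" using u(1) A(1) by (auto simp: schauder_basis_of_def)
  then have "v \<in> V" using span_minimal[OF _ u(2)] A(2) by blast
  then have lim: "(\<lambda>N. coord_proj u {1..N} v) \<longlonglongrightarrow> v" by (rule coord_proj_tendsto[OF u(1)])
  obtain M where M: "F \<subseteq> {..M}" using F(1) finite_nat_iff_bounded_le by blast
  have eq: "coord_proj u A v = coord_proj u G v" if "finite G" "A \<subseteq> G" for G
    unfolding coord_proj_def using that zero by (intro sum.mono_neutral_left) auto
  have "coord_proj u {1..N} v = coord_proj u F v" if "M \<le> N" for N
  proof -
    have "A \<subseteq> {1..N}" using A(1) F(2) M that by force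
    then show ?thesis using eq[of "{1..N}"] eq[OF F] by simp
  qed
  then have "(\<lambda>N. coord_proj u {1..N} v) \<longlonglongrightarrow> coord_proj u F v"
    by (intro tendsto_eventually eventually_sequentiallyI[of M])
  then show "coord_proj u F v = v" using lim LIMSEQ_unique by blast
qed

text \<open>The \<open>i\<close>-th coordinate separates \<open>u i\<close> from the span of the
  other vectors, so the tail is an infinite independent set.\<close>

lemma infinite_dimensional_span_tail:
  assumes "schauder_basis_of u V" "subspace V"
  shows "infinite_dimensional (span (u ` {M<..}))"
  unfolding infinite_dimensional_def
proof
  assume "\<exists>B. finite B \<and> span (u ` {M<..}) \<subseteq> span B"
  then obtain B where B: "finite B" "span (u ` {M<..}) \<subseteq> span B" by blast
  have one: "coords u (u i) i = 1" if "M < i" for i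
    using coords_basis_vector[OF assms, of i] that by simp
  have inj: "inj_on u {M<..}"
  proof (rule inj_onI)
    fix i k assume "i \<in> {M<..}" "k \<in> {M<..}" "u i = u k"
    then show "i = k" using one[of i] coords_basis_vector[OF assms, of k i] by (simp split: if_splits)
  qed
  have "independent (u ` {M<..})"
  proof
    assume "dependent (u ` {M<..})"
    then obtain i where i: "M < i" "u i \<in> span (u ` {M<..} - {u i})" by (auto simp: dependent_def)
    have "u ` {M<..} - {u i} \<subseteq> u ` ({M<..} - {i})" by auto
    then have "u i \<in> span (u ` ({M<..} - {i}))" using i(2) span_mono by blast
    then have "coords u (u i) i = 0" by (intro coords_span_zero[OF assms]) auto
    then show False using one[OF i(1)] by simp
  qed
  moreover have "u ` {M<..} \<subseteq> span B" using span_superset B(2) by (rule order_trans)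
  ultimately have "finite (u ` {M<..})" using independent_span_bound[OF B(1)] by blast
  then have "finite {M<..}" using inj by (rule finite_imageD)
  then show False using infinite_Ioi by blast
qed

lemma infinite_dimensional_kernel:
  fixes f :: "'a::real_vector \<Rightarrow> real"
  assumes "subspace W" "infinite_dimensional W" "linear f"
  shows "infinite_dimensional {v \<in> W. f v = 0}"
  unfolding infinite_dimensional_def
proof
  assume "\<exists>B. finite B \<and> {v \<in> W. f v = 0} \<subseteq> span B"
  then obtain B where B: "finite B" "{v \<in> W. f v = 0} \<subseteq> span B" by blast
  have "\<exists>B. finite B \<and> W \<subseteq> span B"
  proof (cases "\<exists>w\<in>W. f w \<noteq> 0")
    case True
    then obtain w where w: "w \<in> W" "f w \<noteq> 0" by blast
    have "v \<in> span (insert w B)" if "v \<in> W" for v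
    proof -
      have "v - (f v / f w) *\<^sub>R w \<in> {v \<in> W. f v = 0}"
        using that w assms(1,3) by (simp add: subspace_diff subspace_scale linear_diff linear_scale)
      then show ?thesis using B(2) by (auto simp: span_breakdown_eq)
    qed
    then show ?thesis using B(1) by blast
  next
    case False
    then show ?thesis using B by blast
  qed
  then show False using assms(2) by (simp add: infinite_dimensional_def)
qed

subsection \<open>Gliding hump\<close>

context
  fixes x :: "nat \<Rightarrow> 'a::banach"
  assumes basis: "schauder_basis_of x UNIV"
begin

lemma linear_coords: "linear (\<lambda>v. coords x v i)"
  using bounded_linear_coords[OF basis] bounded_linear.linear by blast

lemma linear_coord_proj: "linear (coord_proj x F)"
  by (intro linearI) (simp_all add: coord_proj_add[OF basis] coord_proj_scaleR[OF basis])

text \<open>One form for two kinds of relation that must pass from generators to their closed span: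
  the vanishing of a coordinate (\<open>c = 1\<close>, \<open>d = 0\<close>) and the proportionality
  of two coordinates.\<close>

lemma subspace_coords_relation:
  "subspace {v. c * coords x v i = d * coords x v j}" "closed {v. c * coords x v i = d * coords x v j}"
proof -
  show "subspace {v. c * coords x v i = d * coords x v j}"
    by (intro subspaceI) (simp_all add: linear_0[OF linear_coords] linear_add[OF linear_coords]
        linear_scale[OF linear_coords] algebra_simps)
  have "continuous_on UNIV (\<lambda>v. coords x v i)" for i
    using bounded_linear_coords[OF basis] by (simp add: linear_continuous_on)
  then show "closed {v. c * coords x v i = d * coords x v j}"
    by (intro closed_Collect_eq continuous_on_mult_left)
qed

lemma infinite_dimensional_coords_zero:
  assumes "subspace W" "infinite_dimensional W"
  shows "\<exists>v\<in>W. v \<noteq> 0 \<and> (\<forall>i\<le>N. coords x v i = 0)"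
proof -
  have "subspace {v \<in> W. \<forall>i<N. coords x v i = 0} \<and> infinite_dimensional {v \<in> W. \<forall>i<N. coords x v i = 0}" for N
  proof (induction N)
    case (Suc N)
    have eq: "{v \<in> W. \<forall>i<Suc N. coords x v i = 0} = {v \<in> {v \<in> W. \<forall>i<N. coords x v i = 0}. coords x v N = 0}"
      by (auto simp: less_Suc_eq)
    have "subspace {v. coords x v N = 0}" using subspace_coords_relation(1)[of 1 N 0 N] by simp
    then have "subspace ({v \<in> W. \<forall>i<N. coords x v i = 0} \<inter> {v. coords x v N = 0})"
      using Suc by (intro subspace_inter) auto
    moreover have "{v \<in> W. \<forall>i<N. coords x v i = 0} \<inter> {v. coords x v N = 0} = {v \<in> W. \<forall>i<Suc N. coords x v i = 0}"
      unfolding eq by blast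
    moreover have "infinite_dimensional {v \<in> W. \<forall>i<Suc N. coords x v i = 0}"
      unfolding eq by (intro infinite_dimensional_kernel linear_coords) (use Suc.IH in simp_all)
    ultimately show ?case by simp
  qed (use assms in simp)
  then have inf: "infinite_dimensional {v \<in> W. \<forall>i<Suc N. coords x v i = 0}" by blast
  show ?thesis
  proof (rule ccontr)
    assume "\<not> ?thesis"
    then have "{v \<in> W. \<forall>i<Suc N. coords x v i = 0} \<subseteq> span {}" by (auto simp: less_Suc_eq_le)
    then show False using inf unfolding infinite_dimensional_def by blast
  qed
qed

lemma block_vector_near:
  assumes W: "subspace W" "infinite_dimensional W" and e: "0 < e"
  shows "\<exists>v\<in>W. \<exists>w N'. N < N' \<and> norm w = 1 \<and> w \<in> span (x ` {N<..N'}) \<and> norm (w - v) \<le> e"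
proof -
  obtain v where v: "v \<in> W" "v \<noteq> 0" "\<And>i. i \<le> N \<Longrightarrow> coords x v i = 0"
    using infinite_dimensional_coords_zero[OF W, of N] by blast
  \<comment> \<open>The first bound keeps the truncation \<open>y\<close> at least half as long as
    \<open>v\<close>; given that, the second keeps the error at most \<open>e\<close> after division
    by \<open>norm y\<close>.\<close>
  define d where "d = min (norm v / 2) (e * norm v / 2)"
  have "0 < d" using v e by (simp add: d_def)
  then have "\<forall>\<^sub>F n in sequentially. dist (coord_proj x {1..n} v) v < d"
    using coord_proj_tendsto[OF basis] tendstoD by blast
  then obtain n0 where n0: "\<And>n. n0 \<le> n \<Longrightarrow> dist (coord_proj x {1..n} v) v < d"
    by (auto simp: eventually_sequentially)
  define n where "n = max n0 (Suc N)"
  define y where "y = coord_proj x {1..n} v"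
  have near: "norm (y - v) < d" using n0[of n] by (simp add: n_def y_def dist_norm)
  have "norm v \<le> norm y + norm (y - v)" by (metis add.commute norm_minus_commute norm_triangle_sub)
  then have y: "norm v / 2 \<le> norm y" using near by (simp add: d_def)
  have pos: "0 < norm y" using y v(2) by (metis half_gt_zero_iff less_le_trans zero_less_norm_iff)
  have "y = (\<Sum>i\<in>{N<..n}. coords x v i *\<^sub>R x i)"
    unfolding y_def coord_proj_def using v(3) by (intro sum.mono_neutral_right) auto
  then have "y \<in> span (x ` {N<..n})" by (auto intro: span_sum span_scale span_base)
  moreover have "norm ((1 / norm y) *\<^sub>R y - (1 / norm y) *\<^sub>R v) \<le> e"
  proof -
    have "norm ((1 / norm y) *\<^sub>R y - (1 / norm y) *\<^sub>R v) = norm (y - v) / norm y"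
      using pos by (simp flip: scaleR_diff_right)
    also have "\<dots> \<le> (e * (norm v / 2)) / norm y" using near by (intro divide_right_mono) (auto simp: d_def)
    also have "\<dots> \<le> (e * norm y) / norm y" using y e by (intro divide_right_mono mult_left_mono) auto
    also have "\<dots> = e" using pos by simp
    finally show ?thesis .
  qed
  ultimately show ?thesis
    using pos v(1) W(1)
    by (intro bexI[of _ "(1 / norm y) *\<^sub>R v"] exI[of _ "(1 / norm y) *\<^sub>R y"] exI[of _ n])
      (auto simp: n_def span_scale subspace_scale)
qed

lemma finite_supp_span:
  assumes "z \<in> span (x ` {1..})"
  shows "finite {i. coords x z i \<noteq> 0}"
  using assms
proof (induction rule: span_induct_alt)
  case base
  then show ?case by (simp add: linear_0[OF linear_coords])
next
  case (step c v y)
  then obtain k where k: "1 \<le> k" "v = x k" by auto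
  have "{i. coords x (c *\<^sub>R v + y) i \<noteq> 0} \<subseteq> insert k {i. coords x y i \<noteq> 0}"
    using coords_basis_vector[OF basis subspace_UNIV k(1)]
    by (auto simp: k linear_add[OF linear_coords] linear_scale[OF linear_coords])
  then show ?case using step finite_subset by blast
qed

text \<open>The relation \<open>R\<close> carries the bookkeeping of the subspace in which the vectors \<open>v m\<close> are chosen.\<close>

lemma block_sequence_near:
  fixes R :: "nat \<Rightarrow> 'a \<Rightarrow> nat \<Rightarrow> bool"
  assumes R: "\<And>M. \<exists>W. subspace W \<and> infinite_dimensional W \<and> (\<forall>v\<in>W. \<exists>M'. R M v M')"
    and e: "0 < e"
  shows "\<exists>w v N \<mu>. strict_mono (N :: nat \<Rightarrow> nat) \<and> (\<forall>m. R (\<mu> m) (v m) (\<mu> (Suc m)) \<and> norm (w m) = 1 \<and>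
    w m \<in> span (x ` {N m<..N (Suc m)}) \<and> norm (w m - v m) \<le> e * (1/2) ^ m)"
proof -
  have step: "\<exists>v M' w N'. R M v M' \<and> N < N' \<and> norm w = 1 \<and> w \<in> span (x ` {N<..N'}) \<and> norm (w - v) \<le> d"
    if "0 < d" for M N and d :: real
  proof -
    obtain W where W: "subspace W" "infinite_dimensional W" "\<forall>v\<in>W. \<exists>M'. R M v M'" using R by blast
    show ?thesis using block_vector_near[OF W(1,2) that, of N] W(3) by meson
  qed
  \<comment> \<open>A state holds the bookkeeping index of \<open>R\<close>, the last basis index
    used, and the two vectors chosen on arriving there. Hence \<open>v m\<close> and
    \<open>w m\<close> are read off from state \<open>Suc m\<close> below.\<close>
  let ?Q = "\<lambda>m (M, N, _) (M', N', v, w). R M v M' \<and> N < N' \<and> norm w = 1 \<and> w \<in> span (x ` {N<..N'}) \<and>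
    norm (w - v) \<le> e * (1/2) ^ m"
  have "\<exists>s. \<forall>m. True \<and> ?Q m (s m) (s (Suc m))"
  proof (rule dependent_nat_choice)
    fix s :: "nat \<times> nat \<times> 'a \<times> 'a" and m
    obtain M N v w where s: "s = (M, N, v, w)" by (cases s)
    obtain v' M' w' N' where "R M v' M' \<and> N < N' \<and> norm w' = 1 \<and> w' \<in> span (x ` {N<..N'}) \<and>
        norm (w' - v') \<le> e * (1/2) ^ m"
      using step[of "e * (1/2) ^ m" M N] e by auto
    then show "\<exists>s'. True \<and> ?Q m s s'" unfolding s by (intro exI[of _ "(M', N', v', w')"]) simp
  qed simp
  then obtain s where s: "\<forall>m. True \<and> ?Q m (s m) (s (Suc m))" by (elim exE)
  define \<mu> N v w where "\<mu> m = fst (s m)" and "N m = fst (snd (s m))"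
    and "v m = fst (snd (snd (s (Suc m))))" and "w m = snd (snd (snd (s (Suc m))))" for m
  have s: "R (\<mu> m) (v m) (\<mu> (Suc m)) \<and> N m < N (Suc m) \<and> norm (w m) = 1 \<and>
    w m \<in> span (x ` {N m<..N (Suc m)}) \<and> norm (w m - v m) \<le> e * (1/2) ^ m" for m
    using spec[OF s, of m] by (simp add: \<mu>_def N_def v_def w_def split_def)
  then have "strict_mono N" by (simp add: strict_mono_Suc_iff)
  then show ?thesis using s by blast
qed

text \<open>As \<open>norm (w k) = 1\<close> and \<open>b k *\<^sub>R w k\<close> is a difference of
  two partial sums of \<open>y\<close>, each coefficient is at most \<open>2 * C * norm y\<close>.
  The errors form a geometric series of sum at most \<open>2 * e\<close>, which yields the factor
  \<open>4 * C * e\<close>.\<close>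

lemma block_perturbation:
  assumes C: "0 \<le> C" "\<And>v N. norm (coord_proj x {1..N} v) \<le> C * norm v"
    and N: "strict_mono (N :: nat \<Rightarrow> nat)"
    and w: "\<And>m. norm (w m) = 1" "\<And>m. w m \<in> span (x ` {N m<..N (Suc m)})"
    and near: "\<And>m. norm (w m - v m) \<le> e * (1/2) ^ m"
    and S: "finite S"
  shows "norm ((\<Sum>m\<in>S. b m *\<^sub>R w m) - (\<Sum>m\<in>S. b m *\<^sub>R v m)) \<le> 4 * C * e * norm (\<Sum>m\<in>S. b m *\<^sub>R w m)"
proof -
  define y where "y = (\<Sum>m\<in>S. b m *\<^sub>R w m)"
  have e: "0 \<le> e" using order_trans[OF norm_ge_zero near[of 0]] by simp
  have sub: "{N m<..N (Suc m)} \<subseteq> {1..}" for m by auto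
  have proj: "coord_proj x {1..N k} (w m) = (if m < k then w m else 0)" for k m
  proof (cases "m < k")
    case True
    then have "N (Suc m) \<le> N k" using N by (simp add: strict_mono_less_eq)
    then have "{N m<..N (Suc m)} \<subseteq> {1..N k}" by auto
    then show ?thesis using True coord_proj_span(1)[OF basis subspace_UNIV sub w(2)] by simp
  next
    case False
    then have "N k \<le> N m" using N by (simp add: strict_mono_less_eq)
    then have "{N m<..N (Suc m)} \<inter> {1..N k} = {}" by auto
    then show ?thesis using False coord_proj_span(2)[OF basis subspace_UNIV sub w(2)] by simp
  qed
  have projy: "coord_proj x {1..N k} y = (\<Sum>m\<in>S. b m *\<^sub>R (if m < k then w m else 0))" for k
    unfolding y_def by (simp only: linear_sum[OF linear_coord_proj]
        linear_scale[OF linear_coord_proj] proj)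
  have b: "\<bar>b k\<bar> \<le> 2 * C * norm y" if "k \<in> S" for k
  proof -
    have "coord_proj x {1..N (Suc k)} y - coord_proj x {1..N k} y = (\<Sum>m\<in>S. if m = k then b k *\<^sub>R w k else 0)"
      unfolding projy sum_subtractf[symmetric] by (intro sum.cong) (auto simp: less_Suc_eq)
    also have "\<dots> = b k *\<^sub>R w k" using S that by simp
    finally have "\<bar>b k\<bar> = norm (coord_proj x {1..N (Suc k)} y - coord_proj x {1..N k} y)" by (simp add: w)
    also have "\<dots> \<le> norm (coord_proj x {1..N (Suc k)} y) + norm (coord_proj x {1..N k} y)"
      by (rule norm_triangle_ineq4)
    also have "\<dots> \<le> C * norm y + C * norm y" by (intro add_mono C(2))
    finally show ?thesis by simp
  qed
  have "norm (y - (\<Sum>m\<in>S. b m *\<^sub>R v m)) = norm (\<Sum>m\<in>S. b m *\<^sub>R (w m - v m))"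
    by (simp add: y_def scaleR_diff_right sum_subtractf)
  also have "\<dots> \<le> (\<Sum>m\<in>S. \<bar>b m\<bar> * norm (w m - v m))"
    using norm_sum[of "\<lambda>m. b m *\<^sub>R (w m - v m)" S] by simp
  also have "\<dots> \<le> (\<Sum>m\<in>S. 2 * C * norm y * (e * (1/2) ^ m))"
    using b near C(1) by (intro sum_mono mult_mono) auto
  also have "\<dots> = 2 * C * norm y * e * (\<Sum>m\<in>S. (1/2) ^ m)" by (simp add: sum_distrib_left mult.assoc)
  also have "\<dots> \<le> 2 * C * norm y * e * 2"
  proof (rule mult_left_mono)
    show "(\<Sum>m\<in>S. (1/2::real) ^ m) \<le> 2"
      using sum_le_suminf[OF summable_geometric[of "1/2::real"] S] by (simp add: suminf_geometric)
  qed (use C e in simp)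
  finally show ?thesis by (simp add: y_def mult_ac)
qed

text \<open>The index \<open>\<iota> m\<close> marks a coordinate of the block of \<open>w m\<close>
  at which \<open>w m\<close> does not vanish. A vector of the closed span with finite support over
  \<open>x\<close> is a finite combination of those \<open>w m\<close> whose marked coordinate it
  does not annihilate. Thus vectors with disjoint supports are approximated by combinations of
  disjoint families of the \<open>v m\<close>. The parameter \<open>K\<close> allows passage to
  tails, which pushes supports arbitrarily far out.\<close>

lemma gliding_hump:
  fixes R :: "nat \<Rightarrow> 'a \<Rightarrow> nat \<Rightarrow> bool"
  assumes R: "\<And>M. \<exists>W. subspace W \<and> infinite_dimensional W \<and> (\<forall>v\<in>W. \<exists>M'. R M v M')"
    and e: "0 < e"
  shows "\<exists>w v \<mu> \<iota>. (\<forall>m. R (\<mu> m) (v m) (\<mu> (Suc m))) \<and>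
    (\<forall>K. block_subspace x (closed_span (w ` {K..}))) \<and>
    (\<forall>K. \<forall>z\<in>closed_span (w ` {K..}). (\<forall>i\<le>K. coords x z i = 0) \<and>
      (z \<in> span (x ` {1..}) \<longrightarrow>
        (\<exists>S b. finite S \<and> (\<forall>m\<in>S. coords x z (\<iota> m) \<noteq> 0) \<and>
          norm (z - (\<Sum>m\<in>S. b m *\<^sub>R v m)) \<le> e * norm z)))"
proof -
  obtain C where C: "0 < C" "\<And>v N. norm (coord_proj x {1..N} v) \<le> C * norm v"
    using basis_constant[OF subspace_UNIV closed_UNIV basis] by blast
  \<comment> \<open>Cancels the factor \<open>4 * C\<close> lost in the perturbation
    estimate.\<close>
  define d where "d = e / (4 * C)"
  have d: "0 < d" using e C by (simp add: d_def)
  have "\<exists>w v N \<mu>. strict_mono (N :: nat \<Rightarrow> nat) \<and> (\<forall>m. R (\<mu> m) (v m) (\<mu> (Suc m)) \<and> norm (w m) = 1 \<and>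
      w m \<in> span (x ` {N m<..N (Suc m)}) \<and> norm (w m - v m) \<le> d * (1/2) ^ m)"
    using R d by (rule block_sequence_near)
  then obtain w v :: "nat \<Rightarrow> 'a" and N \<mu> :: "nat \<Rightarrow> nat" where seq: "strict_mono N \<and>
      (\<forall>m. R (\<mu> m) (v m) (\<mu> (Suc m)) \<and> norm (w m) = 1 \<and>
      w m \<in> span (x ` {N m<..N (Suc m)}) \<and> norm (w m - v m) \<le> d * (1/2) ^ m)"
    by (elim exE)
  then have N: "strict_mono N" and Rv: "\<And>m. R (\<mu> m) (v m) (\<mu> (Suc m))"
    and w: "\<And>m. norm (w m) = 1" "\<And>m. w m \<in> span (x ` {N m<..N (Suc m)})"
    and near: "\<And>m. norm (w m - v m) \<le> d * (1/2) ^ m"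
    by simp_all
  have sub: "{N m<..N (Suc m)} \<subseteq> {1..}" for m by auto
  have w0: "coords x (w m) i = 0" if "i \<notin> {N m<..N (Suc m)}" for m i
    using coords_span_zero[OF basis subspace_UNIV sub w(2) that] .
  have same: "m = k" if "i \<in> {N m<..N (Suc m)}" "i \<in> {N k<..N (Suc k)}" for i m k
  proof (rule ccontr)
    assume "m \<noteq> k"
    then consider "Suc m \<le> k" | "Suc k \<le> m" by linarith
    then show False
    proof cases
      case 1
      then have "N (Suc m) \<le> N k" using N by (simp add: strict_mono_less_eq)
      then show False using that by simp
    next
      case 2
      then have "N (Suc k) \<le> N m" using N by (simp add: strict_mono_less_eq)
      then show False using that by simp
    qed
  qed
  have "\<exists>i. i \<in> {N m<..N (Suc m)} \<and> coords x (w m) i \<noteq> 0" for m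
  proof (rule ccontr)
    assume "\<not> ?thesis"
    then have "coords x (w m) i = coords x 0 i" for i
      using w0[of i m] by (auto simp: linear_0[OF linear_coords])
    then have "w m = 0" by (intro coords_ext[OF basis]) auto
    then show False using w(1)[of m] by simp
  qed
  then obtain \<iota> where \<iota>: "\<And>m. \<iota> m \<in> {N m<..N (Suc m)}" "\<And>m. coords x (w m) (\<iota> m) \<noteq> 0" by metis
  have block: "block_subspace x (closed_span (w ` {K..}))" for K
  proof -
    define u where "u n = w (n - 1 + K)" for n
    define F where "F n = {N (n - 1 + K)<..N (Suc (n - 1 + K))}" for n
    \<comment> \<open>A block basis has a single coefficient function for all its blocks. At most
      one block contains \<open>i\<close>, and its number \<open>m\<close> satisfies
      \<open>m \<le> N m < i\<close>, so the sum up to \<open>i\<close> picks up the right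
      coefficient.\<close>
    define a where "a i = (\<Sum>m\<le>i. coords x (w m) i)" for i
    have a: "a i = coords x (w m) i" if i: "i \<in> {N m<..N (Suc m)}" for i m
    proof -
      have "coords x (w k) i = (if k = m then coords x (w m) i else 0)" for k
      proof (cases "k = m")
        case False
        then have "i \<notin> {N k<..N (Suc k)}" using same[OF i] by blast
        then show ?thesis using w0 False by simp
      qed simp
      then have "a i = (\<Sum>k\<le>i. if k = m then coords x (w m) i else 0)" unfolding a_def by (intro sum.cong) auto
      moreover have "m \<le> i" using strict_mono_imp_increasing[OF N, of m] i by auto
      ultimately show ?thesis by simp
    qed
    have sum_u: "u n = (\<Sum>i\<in>F n. a i *\<^sub>R x i)" for n
    proof -
      have "u n = coord_proj x (F n) (u n)"
        using coord_proj_span(1)[OF basis subspace_UNIV sub w(2), of "F n" "n - 1 + K"] by (simp add: F_def u_def)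
      also have "\<dots> = (\<Sum>i\<in>F n. a i *\<^sub>R x i)"
        unfolding coord_proj_def u_def F_def by (intro sum.cong) (auto simp: a)
      finally show ?thesis .
    qed
    have less: "set_less (F m) (F n)" if "m \<in> {1..}" "m < n" for m n
    proof -
      have "N (Suc (m - 1 + K)) \<le> N (n - 1 + K)" using N that by (simp add: strict_mono_less_eq)
      then show ?thesis by (force simp: set_less_def F_def)
    qed
    have nz: "u n \<noteq> 0" for n using w(1)[of "n - 1 + K"] by (auto simp: u_def)
    have F: "finite (F n)" "F n \<subseteq> {1..}" for n by (auto simp: F_def)
    have "block_basis x {1..} u"
      unfolding block_basis_def
      by (rule exI[of _ F], rule exI[of _ a], intro conjI ballI impI; rule F nz sum_u less)
    moreover have "u ` {1..} = w ` {K..}"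
    proof
      show "w ` {K..} \<subseteq> u ` {1..}"
      proof (clarify, rule image_eqI)
        fix m assume "K \<le> m"
        then show "w m = u (m - K + 1)" by (simp add: u_def)
      qed simp
    qed (auto simp: u_def)
    ultimately show ?thesis unfolding block_subspace_def by metis
  qed
  have zero: "coords x z i = 0"
    if z: "z \<in> closed_span (w ` {K..})" and i: "\<And>m. K \<le> m \<Longrightarrow> i \<notin> {N m<..N (Suc m)}" for z i K
  proof -
    have "closed_span (w ` {K..}) \<subseteq> {z. 1 * coords x z i = 0 * coords x z i}"
      using w0 i by (intro closed_span_minimal subspace_coords_relation) auto
    then show ?thesis using z by auto
  qed
  have low: "coords x z i = 0" if z: "z \<in> closed_span (w ` {K..})" and i: "i \<le> K" for z i K
  proof (rule zero[OF z])
    fix m assume "K \<le> m"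
    then show "i \<notin> {N m<..N (Suc m)}" using strict_mono_imp_increasing[OF N, of m] i by auto
  qed
  have rep: "\<exists>S b. finite S \<and> (\<forall>m\<in>S. coords x z (\<iota> m) \<noteq> 0) \<and> norm (z - (\<Sum>m\<in>S. b m *\<^sub>R v m)) \<le> e * norm z"
    if z: "z \<in> closed_span (w ` {K..})" "z \<in> span (x ` {1..})" for z K
  proof -
    define S where "S = {m. K \<le> m \<and> coords x z (\<iota> m) \<noteq> 0}"
    define b where "b m = coords x z (\<iota> m) / coords x (w m) (\<iota> m)" for m
    have "inj \<iota>" using same \<iota>(1) by (metis injI)
    moreover have "\<iota> ` S \<subseteq> {i. coords x z i \<noteq> 0}" by (auto simp: S_def)
    ultimately have S: "finite S"
      using finite_supp_span[OF z(2)] by (meson finite_imageD finite_subset inj_on_subset subset_UNIV)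
    have "z = (\<Sum>m\<in>S. b m *\<^sub>R w m)"
    proof (rule coords_ext[OF basis])
      fix i
      have sum: "coords x (\<Sum>m\<in>S. b m *\<^sub>R w m) i = (\<Sum>m\<in>S. b m * coords x (w m) i)"
        by (simp add: linear_sum[OF linear_coords] linear_scale[OF linear_coords])
      show "coords x z i = coords x (\<Sum>m\<in>S. b m *\<^sub>R w m) i"
      proof (cases "\<exists>m\<ge>K. i \<in> {N m<..N (Suc m)}")
        case True
        then obtain m where m: "K \<le> m" "i \<in> {N m<..N (Suc m)}" by blast
        have other: "coords x (w k) i = 0" "coords x (w k) (\<iota> m) = 0" if "k \<noteq> m" for k
        proof -
          have "i \<notin> {N k<..N (Suc k)}" "\<iota> m \<notin> {N k<..N (Suc k)}"
            using same[OF m(2)] same[OF \<iota>(1)[of m]] that by blast+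
          then show "coords x (w k) i = 0" "coords x (w k) (\<iota> m) = 0" using w0 by blast+
        qed
        \<comment> \<open>Within the block of \<open>w m\<close>, coordinates of any vector of the
          closed span are in the same ratio as those of \<open>w m\<close>. This holds for every
          \<open>w k\<close>, since the others vanish on that block, and it is a closed linear
          condition.\<close>
        have "closed_span (w ` {K..}) \<subseteq>
          {z. coords x (w m) (\<iota> m) * coords x z i = coords x (w m) i * coords x z (\<iota> m)}"
        proof (intro closed_span_minimal subspace_coords_relation)
          show "w ` {K..} \<subseteq> {z. coords x (w m) (\<iota> m) * coords x z i = coords x (w m) i * coords x z (\<iota> m)}"
          proof clarify
            fix k
            show "coords x (w m) (\<iota> m) * coords x (w k) i = coords x (w m) i * coords x (w k) (\<iota> m)"
              using other[of k] by (cases "k = m") auto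
          qed
        qed
        then have zi: "coords x z i = b m * coords x (w m) i"
          using z(1) \<iota>(2)[of m] by (auto simp: b_def field_simps)
        have "(\<Sum>k\<in>S. b k * coords x (w k) i) = (\<Sum>k\<in>S. if k = m then b m * coords x (w m) i else 0)"
          using other by (intro sum.cong) auto
        also have "\<dots> = (if m \<in> S then b m * coords x (w m) i else 0)" using S by simp
        also have "\<dots> = b m * coords x (w m) i" using m(1) by (auto simp: S_def b_def)
        finally show ?thesis using sum zi by simp
      next
        case False
        then have "coords x z i = 0" by (intro zero[OF z(1)]) blast
        moreover have "(\<Sum>m\<in>S. b m * coords x (w m) i) = 0"
          using False w0 by (intro sum.neutral) (metis (no_types, lifting) S_def mem_Collect_eq mult_zero_right)
        ultimately show ?thesis using sum by simp
      qed
    qed simp_all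
    moreover have "norm ((\<Sum>m\<in>S. b m *\<^sub>R w m) - (\<Sum>m\<in>S. b m *\<^sub>R v m)) \<le> 4 * C * d * norm (\<Sum>m\<in>S. b m *\<^sub>R w m)"
      using C by (intro block_perturbation[OF _ _ N w near S]) auto
    ultimately have "norm (z - (\<Sum>m\<in>S. b m *\<^sub>R v m)) \<le> e * norm z" using C by (simp add: d_def)
    then show ?thesis using S by (intro exI[of _ S] exI[of _ b]) (simp add: S_def)
  qed
  show ?thesis
    by (rule exI[of _ w], rule exI[of _ v], rule exI[of _ \<mu>], rule exI[of _ \<iota>],
        intro conjI allI ballI impI; (rule Rv block | erule (1) low | erule (1) rep))
qed

subsection \<open>The contradiction\<close>

lemma block_basis_supp:
  assumes "block_basis x I z"
  shows "i \<in> I \<Longrightarrow> z i \<in> span (x ` {1..})"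
    and "i \<in> I \<Longrightarrow> finite (supp x (z i))"
    and "i \<in> I \<Longrightarrow> supp x (z i) \<noteq> {}"
    and "i \<in> I \<Longrightarrow> l \<in> I \<Longrightarrow> i < l \<Longrightarrow> set_less (supp x (z i)) (supp x (z l))"
proof -
  obtain F a where F: "\<forall>n\<in>I. finite (F n) \<and> F n \<subseteq> {1..} \<and> z n \<noteq> 0 \<and> z n = (\<Sum>i\<in>F n. a i *\<^sub>R x i)"
    "\<forall>m\<in>I. \<forall>n\<in>I. m < n \<longrightarrow> set_less (F m) (F n)"
    using assms unfolding block_basis_def by (elim exE conjE)
  have sub: "supp x (z i) \<subseteq> F i" if "i \<in> I" for i
  proof -
    have Fi: "finite (F i)" "F i \<subseteq> {1..}" "z i = (\<Sum>k\<in>F i. a k *\<^sub>R x k)" using F(1) that by blast+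
    then have "coords x (z i) = (\<lambda>k. if k \<in> F i then a k else 0)"
      using coords_finite_sum[OF basis subspace_UNIV Fi(1,2)] by simp
    then show ?thesis by (auto simp: supp_def split: if_splits)
  qed
  show "z i \<in> span (x ` {1..})" if "i \<in> I"
  proof -
    have Fi: "F i \<subseteq> {1..}" "z i = (\<Sum>k\<in>F i. a k *\<^sub>R x k)" using F(1) that by blast+
    have "(\<Sum>k\<in>F i. a k *\<^sub>R x k) \<in> span (x ` {1..})"
      using Fi(1) by (intro span_sum span_scale span_base) auto
    then show ?thesis using Fi(2) by simp
  qed
  show "finite (supp x (z i))" if "i \<in> I" using sub[OF that] F(1) that finite_subset by blast
  show "supp x (z i) \<noteq> {}" if "i \<in> I"
  proof
    assume "supp x (z i) = {}"
    then have "coords x (z i) k = coords x 0 k" if "1 \<le> k" for k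
      using that by (auto simp: supp_def linear_0[OF linear_coords])
    then have "z i = 0" by (intro coords_ext[OF basis]) auto
    then show False using F(1) that by blast
  qed
  show "set_less (supp x (z i)) (supp x (z l))" if "i \<in> I" "l \<in> I" "i < l"
    using set_less_mono[OF _ sub[OF that(1)] sub[OF that(2)]] F(2) that by blast
qed

lemma block_sum_coords_nonzero:
  assumes z: "block_basis x {1..p} z" and "P \<subseteq> {1..p}" "coords x (\<Sum>i\<in>P. a i *\<^sub>R z i) k \<noteq> 0"
  shows "\<exists>i\<in>P. k \<in> supp x (z i)"
proof (rule ccontr)
  assume no: "\<not> ?thesis"
  have "coords x (z i) k = 0" if "i \<in> P" for i
    using no that coords_0_index[OF basis, of "z i"] by (cases "k = 0") (auto simp: supp_def)
  then have "coords x (\<Sum>i\<in>P. a i *\<^sub>R z i) k = 0"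
    by (simp add: linear_sum[OF linear_coords] linear_scale[OF linear_coords])
  then show False using assms(3) by simp
qed

lemma block_sums_disjoint:
  assumes z: "block_basis x {1..p} z" and P: "P \<subseteq> {1..p}" "Q \<subseteq> {1..p}" "P \<inter> Q = {}"
    and k: "coords x (\<Sum>i\<in>P. a i *\<^sub>R z i) k \<noteq> 0"
  shows "coords x (\<Sum>i\<in>Q. a i *\<^sub>R z i) k = 0"
proof (rule ccontr)
  assume k': "coords x (\<Sum>i\<in>Q. a i *\<^sub>R z i) k \<noteq> 0"
  obtain i where i: "i \<in> P" "k \<in> supp x (z i)" using block_sum_coords_nonzero[OF z P(1) k] by blast
  obtain l where l: "l \<in> Q" "k \<in> supp x (z l)" using block_sum_coords_nonzero[OF z P(2) k'] by blast
  have il: "i \<in> {1..p}" "l \<in> {1..p}" "i \<noteq> l" using i l P by auto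
  then consider "i < l" | "l < i" by linarith
  then show False
    using block_basis_supp(4)[OF z il(1,2)] block_basis_supp(4)[OF z il(2,1)] i(2) l(2)
    by cases (auto simp: set_less_def)
qed

text \<open>The order of choices matters. \<open>K\<close> is fixed first; then \<open>j\<close> is
  taken with \<open>K * (c2 + c3) * \<delta> j < c1\<close>; only then comes \<open>M\<close>, which
  depends on \<open>n j\<close> and \<open>\<delta> j\<close>. The two estimates then give \<open>c1
  * \<delta> j \<le> K * (c2 + c3) * (\<delta> j)\<^sup>2 < c1 * \<delta> j\<close>.\<close>

lemma no_alternating_domination:
  fixes n k :: "nat \<Rightarrow> nat" and \<delta> :: "nat \<Rightarrow> real" and c1 c2 c3 K :: real
  assumes k_less_n: "\<forall>j\<ge>1. k j < n j"
    and \<delta>: "\<forall>j\<ge>1. 0 < \<delta> j" "\<delta> \<longlonglongrightarrow> 0"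
    and c: "0 < c1" "0 < c2" "0 < c3" and K: "0 < K"
    and blocks: "\<And>j M. 1 \<le> j \<Longrightarrow> \<exists>p z. block_basis x {1..p} z \<and>
       lower_estimate x (n j) c1 (\<delta> j) p z \<and> upper_estimate x (k j) c2 c3 (\<delta> j) p z \<and>
       (\<forall>i\<in>{1..p}. M \<le> min_supp x (z i)) \<and>
       (\<forall>a :: nat \<Rightarrow> real. norm (\<Sum>i=1..p. a i *\<^sub>R z i) \<le> K * norm (\<Sum>i=1..p. ((-1) ^ i * a i) *\<^sub>R z i))"
  shows False
proof -
  have "0 < c1 / (K * (c2 + c3))" using c K by simp
  then have "\<forall>\<^sub>F j in sequentially. dist (\<delta> j) 0 < c1 / (K * (c2 + c3)) \<and> 1 \<le> j"
    using \<delta>(2) by (intro eventually_conj tendstoD eventually_ge_at_top)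
  then obtain j where j: "1 \<le> j" "dist (\<delta> j) 0 < c1 / (K * (c2 + c3))"
    by (metis (mono_tags, lifting) eventually_sequentially order_refl)
  have d: "0 < \<delta> j" using \<delta>(1) j by blast
  have dc: "K * (c2 + c3) * \<delta> j < c1" using j(2) d c K by (simp add: pos_less_divide_eq mult.commute)
  \<comment> \<open>The average of order \<open>n j\<close> is small on Schreier sets of order
    \<open>n j - 1\<close>; the strict inequality \<open>k j < n j\<close> puts \<open>k j\<close>
    within that range.\<close>
  obtain m where m: "n j = Suc m" "k j \<le> m" using k_less_n j(1) by (metis less_Suc_eq_le less_imp_Suc_add)
  \<comment> \<open>Makes the smallness bound \<open>(2 ^ n j - 1) / Min T\<close> at most
    \<open>(\<delta> j)\<^sup>2\<close> once the supports start beyond \<open>M\<close>. Asking for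
    \<open>Suc M\<close> below also makes \<open>Min T\<close> visibly positive.\<close>
  obtain M :: nat where M: "(2 ^ n j - 1) / (\<delta> j)\<^sup>2 \<le> real M" using real_arch_simple by blast
  obtain p z where z: "block_basis x {1..p} z" and low: "lower_estimate x (n j) c1 (\<delta> j) p z"
    and up: "upper_estimate x (k j) c2 c3 (\<delta> j) p z"
    and tM: "\<forall>i\<in>{1..p}. Suc M \<le> min_supp x (z i)"
    and dom: "\<forall>a :: nat \<Rightarrow> real. norm (\<Sum>i=1..p. a i *\<^sub>R z i) \<le> K * norm (\<Sum>i=1..p. ((-1) ^ i * a i) *\<^sub>R z i)"
    using blocks[OF j(1), of "Suc M"] by (elim exE conjE)
  define t where "t i = min_supp x (z i)" for i
  have tsupp: "t i \<in> supp x (z i)" if "i \<in> {1..p}" for i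
    unfolding t_def min_supp_def using block_basis_supp(2,3)[OF z that] by (rule Min_in)
  have t: "strict_mono_on {1..p} t"
  proof (rule strict_mono_onI)
    fix i l assume "i \<in> {1..p}" "l \<in> {1..p}" "i < l"
    then have "set_less (supp x (z i)) (supp x (z l))" by (rule block_basis_supp(4)[OF z])
    then show "t i < t l" using tsupp \<open>i \<in> {1..p}\<close> \<open>l \<in> {1..p}\<close> by (simp add: set_less_def)
  qed
  have inj: "inj_on t {1..p}" using t by (rule strict_mono_on_imp_inj_on)
  define T where "T = t ` {1..p}"
  have "maximal_schreier (n j) {t i | i. i \<in> {1..p}}"
    using low by (simp add: lower_estimate_def t_def)
  then have maxT: "maximal_schreier (n j) T" by (simp only: T_def Setcompr_eq_image)
  have full: "full_schreier (n j) T" using maxT by (rule maximal_schreier_full)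
  then obtain \<alpha> where "schreier_average (n j) T \<alpha>" using schreier_average_exists by blast
  then have \<alpha>: "\<And>m. m \<in> T \<Longrightarrow> 0 < \<alpha> m" "sum \<alpha> T = 1"
      "\<And>l m. l \<in> T \<Longrightarrow> m \<in> T \<Longrightarrow> l \<le> m \<Longrightarrow> \<alpha> m \<le> \<alpha> l"
    and small: "\<And>G. G \<in> schreier m \<Longrightarrow> G \<subseteq> T \<Longrightarrow> sum \<alpha> G \<le> (2 ^ n j - 1) / real (Min T)"
    unfolding schreier_average_def using m(1) by blast+
  define a where "a i = \<alpha> (t i)" for i
  have apos: "0 < a i" if "i \<in> {1..p}" for i using that \<alpha>(1) by (simp add: a_def T_def)
  have suma: "(\<Sum>i=1..p. a i) = 1" using \<alpha>(2) inj by (simp add: T_def a_def sum.reindex)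
  have "1 \<le> schreier_norm (n j) (min_supp_vec x p z a)"
  proof -
    let ?y = "min_supp_vec x p z a"
    have yt: "?y (t i) = a i" if "i \<in> {1..p}" for i
      using unit_vec_sum(1)[OF inj that, of a] by (simp add: min_supp_vec_def t_def)
    have "?y m = 0" if "m \<notin> T" for m
      using unit_vec_sum(2)[OF inj, of m a] that by (simp add: min_supp_vec_def t_def T_def)
    then have "{m. ?y m \<noteq> 0} \<subseteq> T" by blast
    then have "finite {m. ?y m \<noteq> 0}" using full_schreier_finite[OF full] by (rule finite_subset)
    then have "(\<Sum>m\<in>T. \<bar>?y m\<bar>) \<le> schreier_norm (n j) ?y"
      using maxT by (intro schreier_norm_ge) (auto simp: maximal_schreier_def)
    moreover have "(\<Sum>m\<in>T. \<bar>?y m\<bar>) = (\<Sum>i=1..p. \<bar>?y (t i)\<bar>)" using inj by (simp add: T_def sum.reindex)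
    moreover have "\<dots> = (\<Sum>i=1..p. a i)" using yt apos by (intro sum.cong) (auto simp: less_imp_le)
    ultimately show ?thesis using suma by simp
  qed
  then have "c1 * \<delta> j * 1 \<le> c1 * \<delta> j * schreier_norm (n j) (min_supp_vec x p z a)"
    using c d by (intro mult_left_mono) auto
  also have "\<dots> \<le> norm (\<Sum>i=1..p. a i *\<^sub>R z i)"
    using low apos unfolding lower_estimate_def by blast
  also have "\<dots> \<le> K * norm (\<Sum>i=1..p. ((-1) ^ i * a i) *\<^sub>R z i)" using dom by blast
  also have "\<dots> \<le> K * (c2 * (\<delta> j)\<^sup>2 + c3 * (\<delta> j)\<^sup>2)"
  proof (rule mult_left_mono)
    have "(\<Sum>i=1..p. \<bar>(-1) ^ i * a i\<bar>) = (\<Sum>i=1..p. a i)"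
      using apos by (intro sum.cong) (auto simp: abs_mult power_abs less_imp_le)
    then have "norm (\<Sum>i=1..p. ((-1) ^ i * a i) *\<^sub>R z i)
        \<le> c2 * cond_schreier_norm (k j) (min_supp_vec x p z (\<lambda>i. (-1) ^ i * a i)) + c3 * (\<delta> j)\<^sup>2"
      using up suma unfolding upper_estimate_def by simp
    moreover have "cond_schreier_norm (k j) (min_supp_vec x p z (\<lambda>i. (-1) ^ i * a i)) \<le> (\<delta> j)\<^sup>2"
      unfolding min_supp_vec_def t_def[symmetric] a_def
    proof (rule cond_schreier_norm_alternating[OF t])
      fix G assume G: "G \<in> schreier (k j)" "G \<subseteq> t ` {1..p}"
      have "Min T \<in> T" using full_schreier_finite[OF full] full_schreier_nonempty[OF full] by (rule Min_in)
      then have "Suc M \<le> Min T" using tM by (auto simp: T_def t_def)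
      then have MT: "0 < real (Min T)" "real M \<le> real (Min T)" by auto
      have "2 ^ n j - 1 \<le> real M * (\<delta> j)\<^sup>2" using M d by (simp add: pos_divide_le_eq)
      also have "\<dots> \<le> real (Min T) * (\<delta> j)\<^sup>2" using MT(2) by (rule mult_right_mono) simp
      finally have "(2 ^ n j - 1) / real (Min T) \<le> (\<delta> j)\<^sup>2" using MT(1) by (simp add: pos_divide_le_eq mult.commute)
      moreover have "sum \<alpha> G \<le> (2 ^ n j - 1) / real (Min T)"
        using G schreier_mono[OF m(2)] by (intro small) (auto simp: T_def)
      ultimately show "sum \<alpha> G \<le> (\<delta> j)\<^sup>2" by linarith
    qed (use \<alpha>(1,3) in \<open>simp_all add: T_def\<close>)
    ultimately show "norm (\<Sum>i=1..p. ((-1) ^ i * a i) *\<^sub>R z i) \<le> c2 * (\<delta> j)\<^sup>2 + c3 * (\<delta> j)\<^sup>2"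
      using mult_left_mono[of "cond_schreier_norm (k j) (min_supp_vec x p z (\<lambda>i. (-1) ^ i * a i))" "(\<delta> j)\<^sup>2" c2] c
      by linarith
  qed (use K in simp)
  also have "\<dots> = (K * (c2 + c3) * \<delta> j) * \<delta> j" by (simp add: power2_eq_square algebra_simps)
  also have "\<dots> < c1 * \<delta> j" using dc d by (intro mult_strict_right_mono)
  finally show False by simp
qed

lemma min_supp_ge:
  assumes "block_basis x {1..p} z" "i \<in> {1..p}" "\<forall>l\<le>M. coords x (z i) l = 0"
  shows "M \<le> min_supp x (z i)"
proof -
  have "min_supp x (z i) \<in> supp x (z i)"
    unfolding min_supp_def using block_basis_supp(2,3)[OF assms(1,2)] by (rule Min_in)
  then have "\<not> min_supp x (z i) \<le> M" using assms(3) by (auto simp: supp_def)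
  then show ?thesis by simp
qed

end

section \<open>From the separation estimate to the two assertions\<close>

text \<open>With \<open>s = norm A + norm B\<close>, replacing \<open>A\<close>, \<open>B\<close> by
  \<open>A'\<close>, \<open>B'\<close> costs \<open>e * s\<close> on each side of
  \<open>dom\<close>, so \<open>s \<le> L * norm (A - B) + (1 + L) * e * s\<close>. The choice of
  \<open>e\<close> makes the last term \<open>s / 2\<close>, which is absorbed on the left and
  doubles \<open>L\<close>. The alternating sum is \<open>B - A\<close>.\<close>

lemma alternating_domination:
  fixes a :: "nat \<Rightarrow> real" and A :: "'a::real_normed_vector"
  assumes L: "0 < L" and e: "e = 1 / (2 * (1 + L))"
    and A: "A = (\<Sum>i\<in>{i\<in>{1..p}. odd i}. a i *\<^sub>R z i)" "norm (A - A') \<le> e * norm A"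
    and B: "B = (\<Sum>i\<in>{i\<in>{1..p}. even i}. a i *\<^sub>R z i)" "norm (B - B') \<le> e * norm B"
    and dom: "norm A' + norm B' \<le> L * norm (A' - B')"
  shows "norm (\<Sum>i=1..p. a i *\<^sub>R z i) \<le> 2 * L * norm (\<Sum>i=1..p. ((-1) ^ i * a i) *\<^sub>R z i)"
proof -
  have split: "(\<Sum>i=1..p. f i) = (\<Sum>i\<in>{i\<in>{1..p}. odd i}. f i) + (\<Sum>i\<in>{i\<in>{1..p}. even i}. f i)"
    for f :: "nat \<Rightarrow> 'a"
  proof -
    have eq: "{i\<in>{1..p}. odd i} \<union> {i\<in>{1..p}. even i} = {1..p}" by auto
    have "sum f ({i\<in>{1..p}. odd i} \<union> {i\<in>{1..p}. even i}) =
        (\<Sum>i\<in>{i\<in>{1..p}. odd i}. f i) + (\<Sum>i\<in>{i\<in>{1..p}. even i}. f i)"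
      by (rule sum.union_disjoint) auto
    then show ?thesis unfolding eq .
  qed
  have plus: "(\<Sum>i=1..p. a i *\<^sub>R z i) = A + B" unfolding A(1) B(1) by (rule split)
  have "(\<Sum>i\<in>{i\<in>{1..p}. odd i}. ((-1) ^ i * a i) *\<^sub>R z i) = - A"
    unfolding A(1) sum_negf[symmetric] by (intro sum.cong) auto
  moreover have "(\<Sum>i\<in>{i\<in>{1..p}. even i}. ((-1) ^ i * a i) *\<^sub>R z i) = B"
    unfolding B(1) by (intro sum.cong) auto
  ultimately have "(\<Sum>i=1..p. ((-1) ^ i * a i) *\<^sub>R z i) = B - A"
    unfolding split[of "\<lambda>i. ((-1) ^ i * a i) *\<^sub>R z i"] by simp
  then have minus: "norm (\<Sum>i=1..p. ((-1) ^ i * a i) *\<^sub>R z i) = norm (A - B)" by (simp add: norm_minus_commute)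
  define s where "s = norm A + norm B"
  have eL: "(1 + L) * e = 1 / 2" using L by (simp add: e field_simps)
  have 1: "norm A \<le> norm A' + norm (A - A')" "norm B \<le> norm B' + norm (B - B')"
    by (metis norm_triangle_sub)+
  have "A' - B' = (A - B) - ((A - A') - (B - B'))" by simp
  then have "norm (A' - B') \<le> norm (A - B) + norm ((A - A') - (B - B'))" by (metis norm_triangle_ineq4)
  also have "norm ((A - A') - (B - B')) \<le> norm (A - A') + norm (B - B')" by (rule norm_triangle_ineq4)
  finally have "norm (A' - B') \<le> norm (A - B) + e * s" using A(2) B(2) by (simp add: s_def distrib_left)
  then have "L * norm (A' - B') \<le> L * (norm (A - B) + e * s)" using L by (intro mult_left_mono) auto
  then have "s \<le> L * (norm (A - B) + e * s) + e * s"
    using 1 A(2) B(2) dom by (simp add: s_def distrib_left)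
  also have "\<dots> = L * norm (A - B) + ((1 + L) * e) * s" by (simp add: algebra_simps)
  finally have "s \<le> 2 * L * norm (A - B)" unfolding eL by simp
  moreover have "norm (A + B) \<le> s" unfolding s_def by (rule norm_triangle_ineq)
  ultimately show ?thesis unfolding plus minus by linarith
qed

lemma span_tail_finite:
  fixes u :: "nat \<Rightarrow> 'a::real_vector"
  assumes "v \<in> span (u ` {M<..})"
  shows "\<exists>M'\<ge>M. v \<in> span (u ` {M<..M'})"
  using assms
proof (induction rule: span_induct_alt)
  case base
  then show ?case by (intro exI[of _ M]) (simp add: span_zero)
next
  case (step c b y)
  then obtain k M1 where k: "M < k" "b = u k" and M1: "M \<le> M1" "y \<in> span (u ` {M<..M1})" by auto
  have "y \<in> span (u ` {M<..max k M1})"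
    using M1(2) span_mono[of "u ` {M<..M1}" "u ` {M<..max k M1}"] by force
  moreover have "b \<in> span (u ` {M<..max k M1})" using k by (intro span_base) auto
  ultimately show ?case using M1(1) by (intro exI[of _ "max k M1"]) (auto intro: span_add span_scale)
qed

text \<open>The projections of \<open>v - w\<close> onto \<open>F\<close> and \<open>G\<close> are
  \<open>v\<close> and \<open>- w\<close>, and both are bounded by the unconditional constant. This
  is the counterpart, for disjoint index sets, of the bounded projection of a closed direct
  sum.\<close>

lemma unconditional_disjoint_spans:
  assumes u: "unconditional_basic_sequence (u :: nat \<Rightarrow> 'a::banach)"
  shows "\<exists>L>0. \<forall>F G v w. finite F \<and> finite G \<and> F \<subseteq> {1..} \<and> G \<subseteq> {1..} \<and> F \<inter> G = {} \<and>
    v \<in> span (u ` F) \<and> w \<in> span (u ` G) \<longrightarrow> norm v + norm w \<le> L * norm (v - w)"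
proof -
  let ?V = "closed_span (u ` {1..})"
  obtain C where C: "0 < C" "\<And>v F. v \<in> ?V \<Longrightarrow> finite F \<Longrightarrow> F \<subseteq> {1..} \<Longrightarrow> norm (coord_proj u F v) \<le> C * norm v"
    using unconditional_constant[OF u] by blast
  have basis: "schauder_basis_of u ?V"
    using u by (simp add: unconditional_basic_sequence_def basic_sequence_def)
  have "norm v + norm w \<le> 2 * C * norm (v - w)"
    if F: "finite F" "F \<subseteq> {1..}" and G: "finite G" "G \<subseteq> {1..}" and FG: "F \<inter> G = {}"
      and v: "v \<in> span (u ` F)" and w: "w \<in> span (u ` G)" for F G v w
  proof -
    have V: "v \<in> ?V" "w \<in> ?V"
      using v w F(2) G(2) span_mono[OF image_mono] span_subset_closed_span by blast+
    have "v - w = v + (-1) *\<^sub>R w" by simp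
    then have proj: "coord_proj u H (v - w) = coord_proj u H v - coord_proj u H w" for H
      using coord_proj_add[OF basis subspace_closed_span V(1) subspace_scale[OF subspace_closed_span V(2)], of H "-1"]
        coord_proj_scaleR[OF basis subspace_closed_span V(2), of H "-1"] by simp
    note span = coord_proj_span[OF basis subspace_closed_span]
    have "coord_proj u F (v - w) = v" "coord_proj u G (v - w) = - w"
      using span(1)[OF F(2) v F(1)] span(1)[OF G(2) w G(1)] span(2)[OF F(2) v FG] span(2)[OF G(2) w, of F] FG
      unfolding proj by (auto simp: Int_commute)
    moreover have "v - w \<in> ?V" using V subspace_diff[OF subspace_closed_span] by blast
    ultimately show ?thesis using C(2)[OF _ F, of "v - w"] C(2)[OF _ G, of "v - w"] by simp
  qed
  then show ?thesis using C(1) by (intro exI[of _ "2 * C"]) auto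
qed

theorem theorem3p6:
  fixes x :: "nat \<Rightarrow> 'a::banach"
    and n k :: "nat \<Rightarrow> nat"
    and \<delta> :: "nat \<Rightarrow> real"
    and c1 c2 c3 :: real
  assumes basis: "schauder_basis_of x (UNIV :: 'a set)"
    and n_incr: "strict_mono_on {1..} n" and n_pos: "\<forall>j\<ge>1. 0 < n j"
    and k_incr: "strict_mono_on {1..} k" and k_pos: "\<forall>j\<ge>1. 0 < k j"
    and k_less_n: "\<forall>j\<ge>1. k j < n j"
    and \<delta>_pos: "\<forall>j\<ge>1. 0 < \<delta> j" and \<delta>_null: "\<delta> \<longlonglongrightarrow> 0"
    and c_pos: "0 < c1" "0 < c2" "0 < c3"
    and blocks: "\<forall>Y. block_subspace x Y \<longrightarrow> (\<forall>j\<ge>1. \<exists>p z.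
       block_basis x {1..p} z \<and> (\<forall>i\<in>{1..p}. z i \<in> Y) \<and>
       lower_estimate x (n j) c1 (\<delta> j) p z \<and>
       upper_estimate x (k j) c2 c3 (\<delta> j) p z)"
  shows "(\<not> (\<exists>u :: nat \<Rightarrow> 'a. unconditional_basic_sequence u)) \<and>
    ((\<forall>Y Z. block_subspace x Y \<longrightarrow> block_subspace x Z \<longrightarrow> (\<forall>j\<ge>1. \<exists>p z.
       block_basis x {1..p} z \<and>
       (\<forall>i\<in>{1..p}. (odd i \<longrightarrow> z i \<in> Y) \<and> (even i \<longrightarrow> z i \<in> Z)) \<and>
       lower_estimate x (n j) c1 (\<delta> j) p z \<and>
       upper_estimate x (k j) c2 c3 (\<delta> j) p z))
     \<longrightarrow> hereditarily_indecomposable (UNIV :: 'a set))"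
proof (intro conjI impI notI)
  assume "\<exists>u :: nat \<Rightarrow> 'a. unconditional_basic_sequence u"
  then obtain u :: "nat \<Rightarrow> 'a" where u: "unconditional_basic_sequence u" by blast
  obtain L where L: "0 < L" and dom: "\<forall>F G v w. finite F \<and> finite G \<and> F \<subseteq> {1..} \<and> G \<subseteq> {1..} \<and> F \<inter> G = {} \<and>
      v \<in> span (u ` F) \<and> w \<in> span (u ` G) \<longrightarrow> norm v + norm w \<le> L * norm (v - w)"
    using unconditional_disjoint_spans[OF u] by (elim exE conjE)
  define e where "e = 1 / (2 * (1 + L))"
  have e: "0 < e" using L by (simp add: e_def)
  \<comment> \<open>Each hump uses finitely many vectors of \<open>u\<close>, with indices in
    \<open>{M<..M'}\<close>; the next one starts after \<open>M'\<close>, so different humps use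
    disjoint parts of \<open>u\<close>.\<close>
  have W: "\<exists>W. subspace W \<and> infinite_dimensional W \<and>
      (\<forall>v\<in>W. \<exists>M'. M \<le> M' \<and> v \<in> span (u ` {M<..M'}))" for M
    using u span_tail_finite infinite_dimensional_span_tail[OF _ subspace_closed_span]
    by (intro exI[of _ "span (u ` {M<..})"])
      (auto simp: unconditional_basic_sequence_def basic_sequence_def)
  obtain w v :: "nat \<Rightarrow> 'a" and \<mu> \<iota> :: "nat \<Rightarrow> nat"
    where \<mu>: "\<forall>m. \<mu> m \<le> \<mu> (Suc m) \<and> v m \<in> span (u ` {\<mu> m<..\<mu> (Suc m)})"
      and block: "\<forall>K. block_subspace x (closed_span (w ` {K..}))"
      and near: "\<forall>K. \<forall>z\<in>closed_span (w ` {K..}). (\<forall>i\<le>K. coords x z i = 0) \<and>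
        (z \<in> span (x ` {1..}) \<longrightarrow> (\<exists>S b. finite S \<and> (\<forall>m\<in>S. coords x z (\<iota> m) \<noteq> 0) \<and>
          norm (z - (\<Sum>m\<in>S. b m *\<^sub>R v m)) \<le> e * norm z))"
    using gliding_hump[OF basis, where R = "\<lambda>M v M'. M \<le> M' \<and> v \<in> span (u ` {M<..M'})", OF W e]
    by (elim exE conjE)
  have mono: "\<mu> l \<le> \<mu> m" if "l \<le> m" for l m using lift_Suc_mono_le[of \<mu>] \<mu> that by blast
  define U where "U m = {\<mu> m<..\<mu> (Suc m)}" for m
  have Udisj: "U l \<inter> U m = {}" if lm: "l \<noteq> m" for l m
  proof -
    consider "Suc l \<le> m" | "Suc m \<le> l" using lm by linarith
    then show ?thesis
    proof cases
      case 1
      then show ?thesis using mono[OF 1] by (auto simp: U_def)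
    next
      case 2
      then show ?thesis using mono[OF 2] by (auto simp: U_def)
    qed
  qed
  show False
  proof (rule no_alternating_domination[OF basis k_less_n \<delta>_pos \<delta>_null c_pos, of "2 * L"])
    fix j M :: nat assume j: "1 \<le> j"
    let ?Y = "closed_span (w ` {M..})"
    obtain p z where z: "block_basis x {1..p} z" and zY: "\<forall>i\<in>{1..p}. z i \<in> ?Y"
      and est: "lower_estimate x (n j) c1 (\<delta> j) p z" "upper_estimate x (k j) c2 c3 (\<delta> j) p z"
      using blocks[rule_format, OF block[rule_format, of M] j] by (elim exE conjE)
    have "norm (\<Sum>i=1..p. a i *\<^sub>R z i) \<le> 2 * L * norm (\<Sum>i=1..p. ((-1) ^ i * a i) *\<^sub>R z i)"
      for a :: "nat \<Rightarrow> real"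
    proof -
      define P Q where "P = {i\<in>{1..p}. odd i}" and "Q = {i\<in>{1..p}. even i}"
      have PQ: "P \<subseteq> {1..p}" "Q \<subseteq> {1..p}" "P \<inter> Q = {}" by (auto simp: P_def Q_def)
      define A B where "A = (\<Sum>i\<in>P. a i *\<^sub>R z i)" and "B = (\<Sum>i\<in>Q. a i *\<^sub>R z i)"
      have AB: "A \<in> ?Y" "B \<in> ?Y" "A \<in> span (x ` {1..})" "B \<in> span (x ` {1..})"
        unfolding A_def B_def using zY block_basis_supp(1)[OF basis z] PQ
        by (auto intro!: subspace_sum[OF subspace_closed_span] subspace_scale[OF subspace_closed_span]
            span_sum span_scale)
      obtain S b where S: "finite S" "\<forall>m\<in>S. coords x A (\<iota> m) \<noteq> 0"
        "norm (A - (\<Sum>m\<in>S. b m *\<^sub>R v m)) \<le> e * norm A"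
        using near AB(1,3) by meson
      obtain S' b' where S': "finite S'" "\<forall>m\<in>S'. coords x B (\<iota> m) \<noteq> 0"
        "norm (B - (\<Sum>m\<in>S'. b' m *\<^sub>R v m)) \<le> e * norm B"
        using near AB(2,4) by meson
      \<comment> \<open>A common \<open>m\<close> would give a coordinate \<open>\<iota> m\<close>
        at which both \<open>A\<close> and \<open>B\<close> are nonzero, although they are sums over
        disjoint sets of blocks of \<open>x\<close>.\<close>
      have disj: "S \<inter> S' = {}"
        using S(2) S'(2) block_sums_disjoint[OF basis z PQ] unfolding A_def B_def by blast
      have comb: "(\<Sum>m\<in>S. b m *\<^sub>R v m) \<in> span (u ` (\<Union>m\<in>S. U m))" for S b
      proof (intro span_sum span_scale)
        fix m assume "m \<in> S"
        then show "v m \<in> span (u ` (\<Union>m\<in>S. U m))"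
          using \<mu> span_mono[of "u ` U m" "u ` (\<Union>m\<in>S. U m)"] unfolding U_def by blast
      qed
      have "norm (\<Sum>m\<in>S. b m *\<^sub>R v m) + norm (\<Sum>m\<in>S'. b' m *\<^sub>R v m)
          \<le> L * norm ((\<Sum>m\<in>S. b m *\<^sub>R v m) - (\<Sum>m\<in>S'. b' m *\<^sub>R v m))"
      proof (rule dom[rule_format], intro conjI)
        show "finite (\<Union>m\<in>S. U m)" "finite (\<Union>m\<in>S'. U m)"
          using S(1) S'(1) by (simp_all add: U_def)
        show "(\<Union>m\<in>S. U m) \<subseteq> {1..}" "(\<Union>m\<in>S'. U m) \<subseteq> {1..}" by (auto simp: U_def)
        have "U l \<inter> U m = {}" if "l \<in> S" "m \<in> S'" for l m
          using disj that by (intro Udisj) auto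
        then show "(\<Union>m\<in>S. U m) \<inter> (\<Union>m\<in>S'. U m) = {}" by fast
      qed (rule comb)+
      then show ?thesis
        by (rule alternating_domination[OF L e_def A_def[unfolded P_def] S(3) B_def[unfolded Q_def] S'(3)])
    qed
    moreover have "M \<le> min_supp x (z i)" if "i \<in> {1..p}" for i
      using min_supp_ge[OF basis z that] near zY that by blast
    ultimately show "\<exists>p z. block_basis x {1..p} z \<and>
       lower_estimate x (n j) c1 (\<delta> j) p z \<and> upper_estimate x (k j) c2 c3 (\<delta> j) p z \<and>
       (\<forall>i\<in>{1..p}. M \<le> min_supp x (z i)) \<and>
       (\<forall>a :: nat \<Rightarrow> real. norm (\<Sum>i=1..p. a i *\<^sub>R z i) \<le> 2 * L * norm (\<Sum>i=1..p. ((-1) ^ i * a i) *\<^sub>R z i))"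
      using z est by (intro exI[of _ p] exI[of _ z]) blast
  qed (use L in simp)
next
  assume two: "\<forall>Y Z. block_subspace x Y \<longrightarrow> block_subspace x Z \<longrightarrow> (\<forall>j\<ge>1. \<exists>p z.
       block_basis x {1..p} z \<and>
       (\<forall>i\<in>{1..p}. (odd i \<longrightarrow> z i \<in> Y) \<and> (even i \<longrightarrow> z i \<in> Z)) \<and>
       lower_estimate x (n j) c1 (\<delta> j) p z \<and>
       upper_estimate x (k j) c2 c3 (\<delta> j) p z)"
  show "hereditarily_indecomposable (UNIV :: 'a set)"
    unfolding hereditarily_indecomposable_def
  proof (intro allI impI notI)
    fix Y Z :: "'a set"
    assume Y: "inf_dim_closed_subspace Y" and Z: "inf_dim_closed_subspace Z"
      and int: "Y \<inter> Z = {0}" and closed: "closed {y + z | y z. y \<in> Y \<and> z \<in> Z}"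
    have Y: "subspace Y" "closed Y" "infinite_dimensional Y" using Y by (auto simp: inf_dim_closed_subspace_def)
    have Z: "subspace Z" "closed Z" "infinite_dimensional Z" using Z by (auto simp: inf_dim_closed_subspace_def)
    obtain C where C: "0 \<le> C" "\<forall>y\<in>Y. \<forall>z\<in>Z. norm y \<le> C * norm (y + z)"
      using bounded_decomposition[OF Y(1,2) Z(1,2) int closed] by blast
    \<comment> \<open>From \<open>norm y \<le> C * norm (y - z)\<close> and
      \<open>norm z \<le> norm y + norm (y - z)\<close>.\<close>
    define L where "L = 2 * C + 1"
    have L: "0 < L" using C(1) by (simp add: L_def)
    have dom: "norm y + norm z \<le> L * norm (y - z)" if "y \<in> Y" "z \<in> Z" for y z
    proof -
      have "- z \<in> Z" using that Z(1) subspace_neg by blast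
      then have "norm y \<le> C * norm (y - z)" using C(2) that(1) by (metis add_uminus_conv_diff)
      moreover have "norm z \<le> norm y + norm (y - z)" by (metis norm_minus_commute norm_triangle_sub)
      ultimately show ?thesis by (simp add: L_def algebra_simps)
    qed
    define e where "e = 1 / (2 * (1 + L))"
    have e: "0 < e" using L by (simp add: e_def)
    have hump: "\<exists>w. (\<forall>K. block_subspace x (closed_span (w ` {K..}))) \<and>
      (\<forall>K. \<forall>z\<in>closed_span (w ` {K..}). (\<forall>i\<le>K. coords x z i = 0) \<and>
        (z \<in> span (x ` {1..}) \<longrightarrow> (\<exists>v\<in>V. norm (z - v) \<le> e * norm z)))"
      if V: "subspace V" "infinite_dimensional V" for V
    proof -
      \<comment> \<open>Membership in \<open>V\<close> is all that has to be recorded: the estimate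
        \<open>dom\<close> holds for arbitrary vectors of \<open>Y\<close> and \<open>Z\<close>,
        whatever the indices of the humps.\<close>
      have W: "\<exists>W. subspace W \<and> infinite_dimensional W \<and> (\<forall>v\<in>W. \<exists>M' :: nat. v \<in> V)" for M :: nat
        using V by blast
      obtain w v :: "nat \<Rightarrow> 'a" and \<iota> :: "nat \<Rightarrow> nat"
        where v: "\<forall>m. v m \<in> V"
          and block: "\<forall>K. block_subspace x (closed_span (w ` {K..}))"
          and near: "\<forall>K. \<forall>z\<in>closed_span (w ` {K..}). (\<forall>i\<le>K. coords x z i = 0) \<and>
            (z \<in> span (x ` {1..}) \<longrightarrow> (\<exists>S b. finite S \<and> (\<forall>m\<in>S. coords x z (\<iota> m) \<noteq> 0) \<and>
              norm (z - (\<Sum>m\<in>S. b m *\<^sub>R v m)) \<le> e * norm z))"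
        using gliding_hump[OF basis, where R = "\<lambda>M v M'. v \<in> V", OF W e] by (elim exE conjE)
      have "(\<Sum>m\<in>S. b m *\<^sub>R v m) \<in> V" for S b
        using v V(1) by (intro subspace_sum subspace_scale) auto
      then show ?thesis using block near by (intro exI[of _ w]) meson
    qed
    obtain w where w: "\<forall>K. block_subspace x (closed_span (w ` {K..}))"
      "\<forall>K. \<forall>z\<in>closed_span (w ` {K..}). (\<forall>i\<le>K. coords x z i = 0) \<and>
        (z \<in> span (x ` {1..}) \<longrightarrow> (\<exists>v\<in>Y. norm (z - v) \<le> e * norm z))"
      using hump[OF Y(1,3)] by (elim exE conjE)
    obtain w' where w': "\<forall>K. block_subspace x (closed_span (w' ` {K..}))"
      "\<forall>K. \<forall>z\<in>closed_span (w' ` {K..}). (\<forall>i\<le>K. coords x z i = 0) \<and>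
        (z \<in> span (x ` {1..}) \<longrightarrow> (\<exists>v\<in>Z. norm (z - v) \<le> e * norm z))"
      using hump[OF Z(1,3)] by (elim exE conjE)
    show False
    proof (rule no_alternating_domination[OF basis k_less_n \<delta>_pos \<delta>_null c_pos, of "2 * L"])
      fix j M :: nat assume j: "1 \<le> j"
      \<comment> \<open>Both tails start at the same \<open>M\<close>, so all minima of supports are
        at least \<open>M\<close>, for odd and even positions alike.\<close>
      let ?Y = "closed_span (w ` {M..})" and ?Z = "closed_span (w' ` {M..})"
      obtain p z where z: "block_basis x {1..p} z"
        and zYZ: "\<forall>i\<in>{1..p}. (odd i \<longrightarrow> z i \<in> ?Y) \<and> (even i \<longrightarrow> z i \<in> ?Z)"
        and est: "lower_estimate x (n j) c1 (\<delta> j) p z" "upper_estimate x (k j) c2 c3 (\<delta> j) p z"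
        using two[rule_format, OF w(1)[rule_format, of M] w'(1)[rule_format, of M] j] by (elim exE conjE)
      have "norm (\<Sum>i=1..p. a i *\<^sub>R z i) \<le> 2 * L * norm (\<Sum>i=1..p. ((-1) ^ i * a i) *\<^sub>R z i)"
        for a :: "nat \<Rightarrow> real"
      proof -
        define A B where "A = (\<Sum>i\<in>{i\<in>{1..p}. odd i}. a i *\<^sub>R z i)"
          and "B = (\<Sum>i\<in>{i\<in>{1..p}. even i}. a i *\<^sub>R z i)"
        have AB: "A \<in> ?Y" "B \<in> ?Z" "A \<in> span (x ` {1..})" "B \<in> span (x ` {1..})"
          unfolding A_def B_def using zYZ block_basis_supp(1)[OF basis z]
          by (auto intro!: subspace_sum[OF subspace_closed_span] subspace_scale[OF subspace_closed_span]
              span_sum span_scale)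
        obtain A' where A': "A' \<in> Y" "norm (A - A') \<le> e * norm A" using w(2) AB(1,3) by blast
        obtain B' where B': "B' \<in> Z" "norm (B - B') \<le> e * norm B" using w'(2) AB(2,4) by blast
        show ?thesis
          using alternating_domination[OF L e_def A_def A'(2) B_def B'(2) dom[OF A'(1) B'(1)]] .
      qed
      moreover have "M \<le> min_supp x (z i)" if "i \<in> {1..p}" for i
        using min_supp_ge[OF basis z that] w(2) w'(2) zYZ that by blast
      ultimately show "\<exists>p z. block_basis x {1..p} z \<and>
         lower_estimate x (n j) c1 (\<delta> j) p z \<and> upper_estimate x (k j) c2 c3 (\<delta> j) p z \<and>
         (\<forall>i\<in>{1..p}. M \<le> min_supp x (z i)) \<and>
         (\<forall>a :: nat \<Rightarrow> real. norm (\<Sum>i=1..p. a i *\<^sub>R z i) \<le> 2 * L * norm (\<Sum>i=1..p. ((-1) ^ i * a i) *\<^sub>R z i))"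
        using z est by (intro exI[of _ p] exI[of _ z]) blast
    qed (use L in simp)
  qed
qed

end
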